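(* Let $A\,|\,B\,|\,C$ be a right depth three tower of rings, and let $V=A^C$, $P=(A\otimes_B A)^C$ and $E=\operatorname{End}{}_BA_C$. The modules ${}_VP$ and $E_V$ are finitely generated projective. If moreover $A\,|\,C$ is left depth two, then the subring $E$ is a right coideal subring of the left $V$-bialgebroid $S=\operatorname{End}{}_CA_C$.
   Context: Rings have identity; a tower of rings $A\,|\,B\,|\,C$ is a pair of unital ring homomorphisms $C\to B\to A$, inducing natural bimodule structures. The tower is right depth three if for some positive integer $N$, $A\otimes_B A$ is isomorphic, as an $A$-$C$-bimodule, to a direct summand of $A^N$. $V=A^C$ is the centralizer of $C$ in $A$; $(A\otimes_B A)^C=\{p: cp=pc\ \forall c\in C\}$; $\operatorname{End}{}_BA_C$ and $\operatorname{End}{}_CA_C$ are the rings (under composition) of $B$-$C$- and $C$-$C$-bimodule endomorphisms of $A$, so $E\subseteq S$. Module structures: $v\cdot p=vp^1\otimes_Bp^2$ for $v\in V$, $p=p^1\otimes_Bp^2\in P$ (finite sum suppressed), and $(\alpha\cdot v)(a)=\alpha(a)v$ for $\alpha\in E$, $v\in V$. $A\,|\,C$ is left depth two if for some positive integer $N$, $A\otimes_C A$ is isomorphic, as a $C$-$A$-bimodule, to a direct summand of $A^N$; equivalently there are finitely many $\beta_j\in S$ and $t_j=t_j^1\otimes_C t_j^2\in(A\otimes_C A)^C$ (left D2 quasibases) with $x\otimes_C y=\sum_j t_j\beta_j(x)y$ for all $x,y\in A$. In this case it is known that $S$ is a left $V$-bialgebroid with $V$-$V$-bimodule structure $(v\cdot\beta\cdot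 v')(a)=v\beta(a)v'$, counit $\beta\mapsto\beta(1)$, and coproduct $\Delta:S\to S\otimes_V S$, $$\Delta(\beta)=\sum_j \beta(-\,t_j^1)t_j^2\otimes_V\beta_j .$$ A subring $E\subseteq S$ that is a right $V$-submodule is a right coideal subring if $\Delta(E)\subseteq E\otimes_V S$ (i.e. the image of $E\otimes_V S$ in $S\otimes_V S$), so that $\Delta$ restricts to $E\to E\otimes_V S$. *)

theory Defs
  imports "HOL-Algebra.Algebra"
begin

text \<open>
  Rings are HOL-Algebra rings (with identity, not necessarily commutative, possibly zero).
  The abelian group underlying a module is a commutative group in multiplicative notation, so
  \<open>add_monoid A\<close> is the group of a ring \<open>A\<close> and \<open>finprod\<close> is the sum in a module; the scalar
  actions are separate arguments.
\<close>

section \<open>Modules over noncommutative rings\<close>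

locale left_module = R: ring R + M: comm_group M
  for R :: "('r, 'k) ring_scheme" and M :: "('m, 'l) monoid_scheme"
    and act :: "'r \<Rightarrow> 'm \<Rightarrow> 'm" +
  assumes act_closed: "\<lbrakk>r \<in> carrier R; x \<in> carrier M\<rbrakk> \<Longrightarrow> act r x \<in> carrier M"
    and act_add_right: "\<lbrakk>r \<in> carrier R; x \<in> carrier M; y \<in> carrier M\<rbrakk>
      \<Longrightarrow> act r (x \<otimes>\<^bsub>M\<^esub> y) = act r x \<otimes>\<^bsub>M\<^esub> act r y"
    and act_add_left: "\<lbrakk>r \<in> carrier R; s \<in> carrier R; x \<in> carrier M\<rbrakk>
      \<Longrightarrow> act (r \<oplus>\<^bsub>R\<^esub> s) x = act r x \<otimes>\<^bsub>M\<^esub> act s x"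
    and act_mult: "\<lbrakk>r \<in> carrier R; s \<in> carrier R; x \<in> carrier M\<rbrakk>
      \<Longrightarrow> act (r \<otimes>\<^bsub>R\<^esub> s) x = act r (act s x)"
    and act_one: "x \<in> carrier M \<Longrightarrow> act \<one>\<^bsub>R\<^esub> x = x"

text \<open>
  Left modules, right modules and bimodules are treated uniformly as abelian groups with
  operators from a set \<open>\<Omega>\<close>: for an \<open>R\<close>-\<open>S\<close>-bimodule, \<open>\<Omega> = carrier R <+> carrier S\<close> and the
  action is \<open>case_sum l r\<close> with \<open>l\<close> the left and \<open>r\<close> the (flipped) right action.
  The definition says that \<open>M\<close> is isomorphic to a subobject \<open>K\<close> of \<open>N\<close> that has a complementary
  subobject \<open>L\<close>.
\<close>

definition iso_direct_summand ::
    "'o set \<Rightarrow> ('m, 'k) monoid_scheme \<Rightarrow> ('o \<Rightarrow> 'm \<Rightarrow> 'm)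
      \<Rightarrow> ('n, 'l) monoid_scheme \<Rightarrow> ('o \<Rightarrow> 'n \<Rightarrow> 'n) \<Rightarrow> bool" where
  "iso_direct_summand \<Omega> M actM N actN \<longleftrightarrow>
    (\<exists>K L f. subgroup K N \<and> subgroup L N
      \<and> (\<forall>w\<in>\<Omega>. actN w ` K \<subseteq> K \<and> actN w ` L \<subseteq> L)
      \<and> K \<inter> L = {\<one>\<^bsub>N\<^esub>} \<and> K <#>\<^bsub>N\<^esub> L = carrier N
      \<and> f \<in> iso M (N\<lparr>carrier := K\<rparr>)
      \<and> (\<forall>w\<in>\<Omega>. \<forall>x\<in>carrier M. f (actM w x) = actN w (f x)))"

definition pointwise_act :: "'i set \<Rightarrow> ('o \<Rightarrow> 'm \<Rightarrow> 'm) \<Rightarrow> 'o \<Rightarrow> ('i \<Rightarrow> 'm) \<Rightarrow> 'i \<Rightarrow> 'm" where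
  "pointwise_act I act w x = (\<lambda>i\<in>I. act w (x i))"

definition fin_gen_module ::
    "('r, 'k) ring_scheme \<Rightarrow> ('m, 'l) monoid_scheme \<Rightarrow> ('r \<Rightarrow> 'm \<Rightarrow> 'm) \<Rightarrow> bool" where
  "fin_gen_module R M act \<longleftrightarrow>
    (\<exists>U. finite U \<and> U \<subseteq> carrier M
      \<and> (\<forall>m\<in>carrier M. \<exists>c\<in>U \<rightarrow> carrier R. m = finprod M (\<lambda>x. act (c x) x) U))"

text \<open>
  Projective: isomorphic to a direct summand of a free module \<open>R\<^sup>(\<^sup>I\<^sup>)\<close>.  Restricting the index
  sets \<open>I\<close> to the element type of \<open>M\<close> loses nothing, since a direct summand of any free module
  is also one of the free module on its own carrier.
\<close>

definition projective_module ::
    "('r, 'k) ring_scheme \<Rightarrow> ('m, 'l) monoid_scheme \<Rightarrow> ('r \<Rightarrow> 'm \<Rightarrow> 'm) \<Rightarrow> bool" where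
  "projective_module R M act \<longleftrightarrow>
    (\<exists>I :: 'm set. iso_direct_summand (carrier R) M act
      (sum_group I (\<lambda>_. add_monoid R)) (pointwise_act I (\<lambda>r a. r \<otimes>\<^bsub>R\<^esub> a)))"

definition fgp_left_module ::
    "('r, 'k) ring_scheme \<Rightarrow> ('m, 'l) monoid_scheme \<Rightarrow> ('r \<Rightarrow> 'm \<Rightarrow> 'm) \<Rightarrow> bool" where
  "fgp_left_module R M act \<longleftrightarrow>
    left_module R M act \<and> fin_gen_module R M act \<and> projective_module R M act"

definition opposite_ring :: "('r, 'k) ring_scheme \<Rightarrow> ('r, 'k) ring_scheme" where
  "opposite_ring R = R\<lparr>monoid.mult := \<lambda>x y. y \<otimes>\<^bsub>R\<^esub> x\<rparr>"

definition fgp_right_module ::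
    "('r, 'k) ring_scheme \<Rightarrow> ('m, 'l) monoid_scheme \<Rightarrow> ('m \<Rightarrow> 'r \<Rightarrow> 'm) \<Rightarrow> bool" where
  "fgp_right_module R M act \<longleftrightarrow> fgp_left_module (opposite_ring R) M (\<lambda>r x. act x r)"

section \<open>Tensor products\<close>

definition tensor_relations ::
    "('r, 'k) ring_scheme \<Rightarrow> ('x, 'l) monoid_scheme \<Rightarrow> ('x \<Rightarrow> 'r \<Rightarrow> 'x)
      \<Rightarrow> ('y, 'n) monoid_scheme \<Rightarrow> ('r \<Rightarrow> 'y \<Rightarrow> 'y) \<Rightarrow> ('x \<times> 'y \<Rightarrow>\<^sub>0 int) set" where
  "tensor_relations R U r W l =
    {frag_of (x \<otimes>\<^bsub>U\<^esub> x', y) - frag_of (x, y) - frag_of (x', y) | x x' y.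
        x \<in> carrier U \<and> x' \<in> carrier U \<and> y \<in> carrier W}
    \<union> {frag_of (x, y \<otimes>\<^bsub>W\<^esub> y') - frag_of (x, y) - frag_of (x, y') | x y y'.
        x \<in> carrier U \<and> y \<in> carrier W \<and> y' \<in> carrier W}
    \<union> {frag_of (r x c, y) - frag_of (x, l c y) | x c y.
        x \<in> carrier U \<and> c \<in> carrier R \<and> y \<in> carrier W}"

definition tensor_kernel ::
    "('r, 'k) ring_scheme \<Rightarrow> ('x, 'l) monoid_scheme \<Rightarrow> ('x \<Rightarrow> 'r \<Rightarrow> 'x)
      \<Rightarrow> ('y, 'n) monoid_scheme \<Rightarrow> ('r \<Rightarrow> 'y \<Rightarrow> 'y) \<Rightarrow> ('x \<times> 'y \<Rightarrow>\<^sub>0 int) set" where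
  "tensor_kernel R U r W l =
    generate (free_Abelian_group (carrier U \<times> carrier W)) (tensor_relations R U r W l)"

definition tensor_product ::
    "('r, 'k) ring_scheme \<Rightarrow> ('x, 'l) monoid_scheme \<Rightarrow> ('x \<Rightarrow> 'r \<Rightarrow> 'x)
      \<Rightarrow> ('y, 'n) monoid_scheme \<Rightarrow> ('r \<Rightarrow> 'y \<Rightarrow> 'y) \<Rightarrow> ('x \<times> 'y \<Rightarrow>\<^sub>0 int) set monoid" where
  "tensor_product R U r W l =
    free_Abelian_group (carrier U \<times> carrier W) Mod tensor_kernel R U r W l"

definition pure_tensor ::
    "('r, 'k) ring_scheme \<Rightarrow> ('x, 'l) monoid_scheme \<Rightarrow> ('x \<Rightarrow> 'r \<Rightarrow> 'x)
      \<Rightarrow> ('y, 'n) monoid_scheme \<Rightarrow> ('r \<Rightarrow> 'y \<Rightarrow> 'y) \<Rightarrow> 'x \<Rightarrow> 'y \<Rightarrow> ('x \<times> 'y \<Rightarrow>\<^sub>0 int) set" where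
  "pure_tensor R U r W l x y =
    tensor_kernel R U r W l #>\<^bsub>free_Abelian_group (carrier U \<times> carrier W)\<^esub> frag_of (x, y)"

text \<open>
  The homomorphism into \<open>G\<close> induced by a balanced biadditive map \<open>h\<close>, evaluated at a coset \<open>q\<close>
  of the tensor relations: \<open>x \<otimes> y\<close> goes to \<open>h x y\<close>.  For balanced \<open>h\<close> the value does not depend
  on the representative \<open>p\<close> of \<open>q\<close>.
\<close>

definition tensor_lift ::
    "('g, 'k) monoid_scheme \<Rightarrow> ('x \<Rightarrow> 'y \<Rightarrow> 'g) \<Rightarrow> ('x \<times> 'y \<Rightarrow>\<^sub>0 int) set \<Rightarrow> 'g" where
  "tensor_lift G h q =
    (THE z. \<exists>p\<in>q. z = finprod G (\<lambda>(x, y). h x y [^]\<^bsub>G\<^esub> Poly_Mapping.lookup p (x, y))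
                        (Poly_Mapping.keys p))"

section \<open>Ring extensions\<close>

text \<open>
  A ring extension \<open>A | R\<close> is given by a unital ring homomorphism \<open>\<rho>\<close> from \<open>R\<close> to \<open>A\<close>, not
  necessarily injective; \<open>r \<in> R\<close> acts on \<open>A\<close> through multiplication by \<open>\<rho> r\<close>.
\<close>

definition ext_tensor ::
    "('a, 'k) ring_scheme \<Rightarrow> ('r, 'l) ring_scheme \<Rightarrow> ('r \<Rightarrow> 'a) \<Rightarrow> ('a \<times> 'a \<Rightarrow>\<^sub>0 int) set monoid" where
  "ext_tensor A R \<rho> =
    tensor_product R (add_monoid A) (\<lambda>a r. a \<otimes>\<^bsub>A\<^esub> \<rho> r) (add_monoid A) (\<lambda>r a. \<rho> r \<otimes>\<^bsub>A\<^esub> a)"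

definition ext_pure ::
    "('a, 'k) ring_scheme \<Rightarrow> ('r, 'l) ring_scheme \<Rightarrow> ('r \<Rightarrow> 'a) \<Rightarrow> 'a \<Rightarrow> 'a
      \<Rightarrow> ('a \<times> 'a \<Rightarrow>\<^sub>0 int) set" where
  "ext_pure A R \<rho> =
    pure_tensor R (add_monoid A) (\<lambda>a r. a \<otimes>\<^bsub>A\<^esub> \<rho> r) (add_monoid A) (\<lambda>r a. \<rho> r \<otimes>\<^bsub>A\<^esub> a)"

definition ext_tensor_left ::
    "('a, 'k) ring_scheme \<Rightarrow> ('r, 'l) ring_scheme \<Rightarrow> ('r \<Rightarrow> 'a)
      \<Rightarrow> 'a \<Rightarrow> ('a \<times> 'a \<Rightarrow>\<^sub>0 int) set \<Rightarrow> ('a \<times> 'a \<Rightarrow>\<^sub>0 int) set" where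
  "ext_tensor_left A R \<rho> a =
    tensor_lift (ext_tensor A R \<rho>) (\<lambda>x y. ext_pure A R \<rho> (a \<otimes>\<^bsub>A\<^esub> x) y)"

definition ext_tensor_right ::
    "('a, 'k) ring_scheme \<Rightarrow> ('r, 'l) ring_scheme \<Rightarrow> ('r \<Rightarrow> 'a)
      \<Rightarrow> ('a \<times> 'a \<Rightarrow>\<^sub>0 int) set \<Rightarrow> 'a \<Rightarrow> ('a \<times> 'a \<Rightarrow>\<^sub>0 int) set" where
  "ext_tensor_right A R \<rho> q a =
    tensor_lift (ext_tensor A R \<rho>) (\<lambda>x y. ext_pure A R \<rho> x (y \<otimes>\<^bsub>A\<^esub> a)) q"

definition centralizer_ring ::
    "('a, 'k) ring_scheme \<Rightarrow> ('c, 'l) ring_scheme \<Rightarrow> ('c \<Rightarrow> 'a) \<Rightarrow> ('a, 'k) ring_scheme" where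
  "centralizer_ring A C \<gamma> =
    A\<lparr>carrier := {v \<in> carrier A. \<forall>c\<in>carrier C. \<gamma> c \<otimes>\<^bsub>A\<^esub> v = v \<otimes>\<^bsub>A\<^esub> \<gamma> c}\<rparr>"

text \<open>\<open>(A \<otimes>\<^sub>R A)\<^sup>C\<close>, where \<open>\<gamma>\<close> is the homomorphism from \<open>C\<close> to \<open>A\<close>.\<close>

definition ext_tensor_centralizer ::
    "('a, 'k) ring_scheme \<Rightarrow> ('r, 'l) ring_scheme \<Rightarrow> ('r \<Rightarrow> 'a)
      \<Rightarrow> ('c, 'n) ring_scheme \<Rightarrow> ('c \<Rightarrow> 'a) \<Rightarrow> ('a \<times> 'a \<Rightarrow>\<^sub>0 int) set monoid" where
  "ext_tensor_centralizer A R \<rho> C \<gamma> =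
    (ext_tensor A R \<rho>)\<lparr>carrier := {p \<in> carrier (ext_tensor A R \<rho>).
      \<forall>c\<in>carrier C. ext_tensor_left A R \<rho> (\<gamma> c) p = ext_tensor_right A R \<rho> p (\<gamma> c)}\<rparr>"

text \<open>
  The ring of \<open>R\<close>-\<open>T\<close>-bimodule endomorphisms of \<open>A\<close> under composition.  Its elements are
  extensional, so that equality in the ring is equality of maps on \<open>carrier A\<close>.
\<close>

definition bimod_End ::
    "('a, 'k) ring_scheme \<Rightarrow> ('r, 'l) ring_scheme \<Rightarrow> ('r \<Rightarrow> 'a)
      \<Rightarrow> ('t, 'n) ring_scheme \<Rightarrow> ('t \<Rightarrow> 'a) \<Rightarrow> ('a \<Rightarrow> 'a) ring" where
  "bimod_End A R \<rho> T \<tau> =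
    \<lparr>carrier = {f \<in> hom (add_monoid A) (add_monoid A) \<inter> extensional (carrier A).
        (\<forall>r\<in>carrier R. \<forall>a\<in>carrier A. f (\<rho> r \<otimes>\<^bsub>A\<^esub> a) = \<rho> r \<otimes>\<^bsub>A\<^esub> f a) \<and>
        (\<forall>t\<in>carrier T. \<forall>a\<in>carrier A. f (a \<otimes>\<^bsub>A\<^esub> \<tau> t) = f a \<otimes>\<^bsub>A\<^esub> \<tau> t)},
     monoid.mult = compose (carrier A),
     one = (\<lambda>a\<in>carrier A. a),
     ring.zero = (\<lambda>a\<in>carrier A. \<zero>\<^bsub>A\<^esub>),
     ring.add = (\<lambda>f g. \<lambda>a\<in>carrier A. f a \<oplus>\<^bsub>A\<^esub> g a)\<rparr>"

definition End_right :: "('a, 'k) ring_scheme \<Rightarrow> ('a \<Rightarrow> 'a) \<Rightarrow> 'a \<Rightarrow> 'a \<Rightarrow> 'a" where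
  "End_right A f v = (\<lambda>a\<in>carrier A. f a \<otimes>\<^bsub>A\<^esub> v)"

definition End_left :: "('a, 'k) ring_scheme \<Rightarrow> 'a \<Rightarrow> ('a \<Rightarrow> 'a) \<Rightarrow> 'a \<Rightarrow> 'a" where
  "End_left A v f = (\<lambda>a\<in>carrier A. v \<otimes>\<^bsub>A\<^esub> f a)"

section \<open>Depth conditions\<close>

text \<open>The tower \<open>A | B | C\<close> is given by \<open>\<phi>\<close> from \<open>C\<close> to \<open>B\<close> and \<open>\<psi>\<close> from \<open>B\<close> to \<open>A\<close>.\<close>

definition right_depth_three ::
    "('a, 'k) ring_scheme \<Rightarrow> ('b, 'l) ring_scheme \<Rightarrow> ('c, 'n) ring_scheme
      \<Rightarrow> ('c \<Rightarrow> 'b) \<Rightarrow> ('b \<Rightarrow> 'a) \<Rightarrow> bool" where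
  "right_depth_three A B C \<phi> \<psi> \<longleftrightarrow>
    (\<exists>N::nat. N > 0 \<and>
      iso_direct_summand (carrier A <+> carrier C)
        (ext_tensor A B \<psi>)
        (case_sum (ext_tensor_left A B \<psi>) (\<lambda>c q. ext_tensor_right A B \<psi> q (\<psi> (\<phi> c))))
        (product_group {..<N} (\<lambda>_. add_monoid A))
        (pointwise_act {..<N} (case_sum (\<lambda>a x. a \<otimes>\<^bsub>A\<^esub> x) (\<lambda>c x. x \<otimes>\<^bsub>A\<^esub> \<psi> (\<phi> c)))))"

definition left_depth_two ::
    "('a, 'k) ring_scheme \<Rightarrow> ('c, 'n) ring_scheme \<Rightarrow> ('c \<Rightarrow> 'a) \<Rightarrow> bool" where
  "left_depth_two A C \<gamma> \<longleftrightarrow>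
    (\<exists>N::nat. N > 0 \<and>
      iso_direct_summand (carrier C <+> carrier A)
        (ext_tensor A C \<gamma>)
        (case_sum (\<lambda>c. ext_tensor_left A C \<gamma> (\<gamma> c)) (\<lambda>a q. ext_tensor_right A C \<gamma> q a))
        (product_group {..<N} (\<lambda>_. add_monoid A))
        (pointwise_act {..<N} (case_sum (\<lambda>c x. \<gamma> c \<otimes>\<^bsub>A\<^esub> x) (\<lambda>a x. x \<otimes>\<^bsub>A\<^esub> a))))"

section \<open>The bialgebroid of a left depth two extension\<close>

definition left_D2_quasibases ::
    "('a, 'k) ring_scheme \<Rightarrow> ('c, 'n) ring_scheme \<Rightarrow> ('c \<Rightarrow> 'a)
      \<Rightarrow> nat \<Rightarrow> (nat \<Rightarrow> 'a \<Rightarrow> 'a) \<Rightarrow> (nat \<Rightarrow> ('a \<times> 'a \<Rightarrow>\<^sub>0 int) set) \<Rightarrow> bool" where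
  "left_D2_quasibases A C \<gamma> n \<beta> t \<longleftrightarrow>
    (\<forall>j<n. \<beta> j \<in> carrier (bimod_End A C \<gamma> C \<gamma>)
         \<and> t j \<in> carrier (ext_tensor_centralizer A C \<gamma> C \<gamma>))
    \<and> (\<forall>x\<in>carrier A. \<forall>y\<in>carrier A.
         ext_pure A C \<gamma> x y =
           finprod (ext_tensor A C \<gamma>)
             (\<lambda>j. ext_tensor_right A C \<gamma> (t j) (\<beta> j x \<otimes>\<^bsub>A\<^esub> y)) {..<n})"

definition D2_tensor ::
    "('a, 'k) ring_scheme \<Rightarrow> ('c, 'n) ring_scheme \<Rightarrow> ('c \<Rightarrow> 'a)
      \<Rightarrow> (('a \<Rightarrow> 'a) \<times> ('a \<Rightarrow> 'a) \<Rightarrow>\<^sub>0 int) set monoid" where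
  "D2_tensor A C \<gamma> =
    tensor_product (centralizer_ring A C \<gamma>)
      (add_monoid (bimod_End A C \<gamma> C \<gamma>)) (End_right A)
      (add_monoid (bimod_End A C \<gamma> C \<gamma>)) (End_left A)"

definition D2_pure ::
    "('a, 'k) ring_scheme \<Rightarrow> ('c, 'n) ring_scheme \<Rightarrow> ('c \<Rightarrow> 'a)
      \<Rightarrow> ('a \<Rightarrow> 'a) \<Rightarrow> ('a \<Rightarrow> 'a) \<Rightarrow> (('a \<Rightarrow> 'a) \<times> ('a \<Rightarrow> 'a) \<Rightarrow>\<^sub>0 int) set" where
  "D2_pure A C \<gamma> =
    pure_tensor (centralizer_ring A C \<gamma>)
      (add_monoid (bimod_End A C \<gamma> C \<gamma>)) (End_right A)
      (add_monoid (bimod_End A C \<gamma> C \<gamma>)) (End_left A)"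

text \<open>The map \<open>\<alpha>(- t\<^sup>1) t\<^sup>2\<close> for \<open>t = t\<^sup>1 \<otimes>\<^sub>C t\<^sup>2\<close> (finite sum suppressed).\<close>

definition D2_contract :: "('a, 'k) ring_scheme \<Rightarrow> ('a \<Rightarrow> 'a) \<Rightarrow> ('a \<times> 'a \<Rightarrow>\<^sub>0 int) set \<Rightarrow> 'a \<Rightarrow> 'a" where
  "D2_contract A \<alpha> t =
    (\<lambda>a\<in>carrier A. tensor_lift (add_monoid A) (\<lambda>x y. \<alpha> (a \<otimes>\<^bsub>A\<^esub> x) \<otimes>\<^bsub>A\<^esub> y) t)"

text \<open>
  The coproduct is the common value of \<open>\<Sum>\<^sub>j \<alpha>(- t\<^sub>j\<^sup>1) t\<^sub>j\<^sup>2 \<otimes>\<^sub>V \<beta>\<^sub>j\<close> over all left D2 quasibases;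
  for a left depth two extension these exist and the value does not depend on them.
\<close>

definition D2_coproduct ::
    "('a, 'k) ring_scheme \<Rightarrow> ('c, 'n) ring_scheme \<Rightarrow> ('c \<Rightarrow> 'a)
      \<Rightarrow> ('a \<Rightarrow> 'a) \<Rightarrow> (('a \<Rightarrow> 'a) \<times> ('a \<Rightarrow> 'a) \<Rightarrow>\<^sub>0 int) set" where
  "D2_coproduct A C \<gamma> \<alpha> =
    (THE w. \<exists>n \<beta> t. left_D2_quasibases A C \<gamma> n \<beta> t \<and>
      w = finprod (D2_tensor A C \<gamma>) (\<lambda>j. D2_pure A C \<gamma> (D2_contract A \<alpha> (t j)) (\<beta> j)) {..<n})"

text \<open>
  Right coideal subrings \<open>E\<close> of a left \<open>V\<close>-bialgebroid \<open>S\<close>; of the bialgebroid structure only the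
  ring \<open>S\<close>, the \<open>V\<close>-\<open>V\<close>-bimodule structure (\<open>l\<close>, \<open>r\<close>) and the coproduct \<open>\<Delta>\<close> enter.
  The last conjunct says that \<open>\<Delta>(E)\<close> lies in the image of the canonical map
  from \<open>E \<otimes>\<^sub>V S\<close> to \<open>S \<otimes>\<^sub>V S\<close>.
\<close>

definition right_coideal_subring ::
    "('v, 'k) ring_scheme \<Rightarrow> ('s, 'n) ring_scheme \<Rightarrow> ('v \<Rightarrow> 's \<Rightarrow> 's) \<Rightarrow> ('s \<Rightarrow> 'v \<Rightarrow> 's)
      \<Rightarrow> ('s \<Rightarrow> ('s \<times> 's \<Rightarrow>\<^sub>0 int) set) \<Rightarrow> 's set \<Rightarrow> bool" where
  "right_coideal_subring V S l r \<Delta> E \<longleftrightarrow>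
    subring E S
    \<and> (\<forall>e\<in>E. \<forall>v\<in>carrier V. r e v \<in> E)
    \<and> \<Delta> ` E \<subseteq>
        tensor_lift (tensor_product V (add_monoid S) r (add_monoid S) l)
          (pure_tensor V (add_monoid S) r (add_monoid S) l)
        ` carrier (tensor_product V (add_monoid (S\<lparr>carrier := E\<rparr>)) r (add_monoid S) l)"

end

theory Submission
  imports Defs
begin

text \<open>
  Depth three splits \<open>A \<otimes>\<^sub>B A\<close> off \<open>A\<^sup>N\<close>, which gives elements \<open>u\<^sub>i \<in> P\<close> and bimodule maps
  \<open>f\<^sub>i\<close> from \<open>A \<otimes>\<^sub>B A\<close> to \<open>A\<close> with \<open>q = \<Sum>\<^sub>i f\<^sub>i(q) u\<^sub>i\<close>.  Since \<open>f\<^sub>i\<close> maps \<open>P\<close> into \<open>V\<close>, this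
  is a dual basis of \<open>P\<close>; the maps \<open>y \<mapsto> f\<^sub>i(1 \<otimes> y)\<close> in \<open>E\<close> together with the functionals
  \<open>\<alpha> \<mapsto> u\<^sub>i\<^sup>1 \<alpha>(u\<^sub>i\<^sup>2) \<in> V\<close> form one of \<open>E\<close>.  For the coideal property, \<open>\<alpha>(- t\<^sup>1) t\<^sup>2\<close> is
  \<open>B\<close>-\<open>C\<close>-linear whenever \<open>\<alpha>\<close> is and \<open>t\<close> centralizes \<open>C\<close>, so every summand of the coproduct of
  \<open>\<alpha> \<in> E\<close> has its first factor in \<open>E\<close>.
\<close>

section \<open>Finite products in commutative groups\<close>

text \<open>The unit vectors of A^N commute with C because 1 does, and the projection of A^N onto
  its summand is a bimodule map; this is why their images u_i centralize C. For the same reason a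
  bimodule map to A takes elements commuting with C to elements commuting with C. Two definite
  descriptions shape the rest. The map induced on a tensor product is read off from an arbitrary
  representative of a coset, so every balanced map first has to be shown constant on cosets;
  afterwards identities are checked on pure tensors only. The coproduct is a description over all
  left D2 quasibases, so before anything can be said about \<Delta>(E), quasibases must be
  constructed from depth two and two systems of them must be shown to give the same sum. The coideal
  condition concerns the image of E \<otimes>_V S in S \<otimes>_V S. Injectivity of the canonical
  map is not at issue: a preimage of \<Delta>(\<alpha>) is obtained by reading the defining sum in E
  \<otimes>_V S.\<close>

lemma hom_finprod:
  assumes "comm_group G" "comm_group H" "h \<in> hom G H" "f \<in> I \<rightarrow> carrier G"
  shows "h (finprod G f I) = finprod H (\<lambda>i. h (f i)) I"
proof -
  interpret G: comm_group G by fact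
  interpret H: comm_group H by fact
  interpret group_hom G H h
    using assms(3) by unfold_locales
  show ?thesis
    using assms(4)
  proof (induction I rule: infinite_finite_induct)
    case (insert i I)
    then have "(\<lambda>i. h (f i)) \<in> I \<rightarrow> carrier H"
      by (auto simp: Pi_iff)
    with insert show ?case
      by (simp add: Pi_iff)
  qed auto
qed

lemma finprod_hom:
  assumes "comm_group G" "\<And>i. i \<in> I \<Longrightarrow> f i \<in> hom M G"
  shows "(\<lambda>x. finprod G (\<lambda>i. f i x) I) \<in> hom M G"
proof -
  interpret G: comm_group G by fact
  have closed: "f i x \<in> carrier G" if "i \<in> I" "x \<in> carrier M" for i x
    using assms(2)[OF that(1)] that(2) by (auto simp: hom_def)
  show ?thesis
  proof (rule homI)
    fix x y assume "x \<in> carrier M" "y \<in> carrier M"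
    then have "finprod G (\<lambda>i. f i (x \<otimes>\<^bsub>M\<^esub> y)) I = finprod G (\<lambda>i. f i x \<otimes>\<^bsub>G\<^esub> f i y) I"
      by (intro G.finprod_cong') (auto simp: closed hom_mult[OF assms(2)])
    also have "\<dots> = finprod G (\<lambda>i. f i x) I \<otimes>\<^bsub>G\<^esub> finprod G (\<lambda>i. f i y) I"
      using \<open>x \<in> carrier M\<close> \<open>y \<in> carrier M\<close> by (intro G.finprod_multf) (auto simp: closed)
    finally show "finprod G (\<lambda>i. f i (x \<otimes>\<^bsub>M\<^esub> y)) I = finprod G (\<lambda>i. f i x) I \<otimes>\<^bsub>G\<^esub> finprod G (\<lambda>i. f i y) I" .
  qed (auto intro!: G.finprod_closed simp: closed)
qed

text \<open>Interchanges the double sum that arises when one system of quasibases is expanded in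
  another.\<close>

lemma (in comm_group) finprod_swap:
  assumes "\<And>i j. i \<in> I \<Longrightarrow> j \<in> J \<Longrightarrow> f i j \<in> carrier G" "finite I" "finite J"
  shows "finprod G (\<lambda>i. finprod G (f i) J) I = finprod G (\<lambda>j. finprod G (\<lambda>i. f i j) I) J"
  using assms(2,1)
proof (induction I rule: finite_induct)
  case (insert i I)
  have "finprod G (\<lambda>i. finprod G (f i) J) (insert i I)
      = finprod G (f i) J \<otimes> finprod G (\<lambda>j. finprod G (\<lambda>i. f i j) I) J"
    using insert by (subst finprod_insert) auto
  also have "\<dots> = finprod G (\<lambda>j. f i j \<otimes> finprod G (\<lambda>i. f i j) I) J"
    using insert by (subst finprod_multf) auto
  also have "\<dots> = finprod G (\<lambda>j. finprod G (\<lambda>i. f i j) (insert i I)) J"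
    using insert by (intro finprod_cong') (auto simp: Pi_iff)
  finally show ?case .
qed simp

text \<open>Universal property of the free abelian group, in the form in which
  \<open>tensor_lift\<close> evaluates a representative.\<close>

lemma free_Abelian_group_hom_finprod:
  assumes "comm_group G" "h \<in> S \<rightarrow> carrier G"
  shows "(\<lambda>p. finprod G (\<lambda>z. h z [^]\<^bsub>G\<^esub> Poly_Mapping.lookup p z) (Poly_Mapping.keys p))
      \<in> hom (free_Abelian_group S) G" (is "?h \<in> _")
proof -
  interpret G: comm_group G by fact
  have closed: "h z \<in> carrier G" if "z \<in> S" for z
    using assms(2) that by auto
  \<comment> \<open>The index set of the product depends on p, and cancellation can make the support
    of p + q smaller than the union of the supports. Enlarging the index set only adds factors with
    exponent 0, so all three products can be compared over the union.\<close>
  have ext: "?h p = finprod G (\<lambda>z. h z [^]\<^bsub>G\<^esub> Poly_Mapping.lookup p z) T"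
    if "Poly_Mapping.keys p \<subseteq> T" "finite T" "T \<subseteq> S" for p T
    using that by (intro G.finprod_mono_neutral_cong_left) (auto intro!: G.int_pow_closed closed simp: in_keys_iff)
  show ?thesis
  proof (rule homI)
    fix p assume "p \<in> carrier (free_Abelian_group S)"
    then show "?h p \<in> carrier G"
      by (auto intro!: G.finprod_closed G.int_pow_closed closed)
  next
    fix p q assume pq: "p \<in> carrier (free_Abelian_group S)" "q \<in> carrier (free_Abelian_group S)"
    let ?T = "Poly_Mapping.keys p \<union> Poly_Mapping.keys q"
    have T: "finite ?T" "?T \<subseteq> S"
      using pq by auto
    have "?h (p + q) = finprod G (\<lambda>z. h z [^]\<^bsub>G\<^esub> Poly_Mapping.lookup (p + q) z) ?T"
      using T Poly_Mapping.keys_add[of p q] by (intro ext) auto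
    also have "\<dots> = finprod G (\<lambda>z. h z [^]\<^bsub>G\<^esub> Poly_Mapping.lookup p z
        \<otimes>\<^bsub>G\<^esub> h z [^]\<^bsub>G\<^esub> Poly_Mapping.lookup q z) ?T"
      using T by (intro G.finprod_cong')
        (auto simp: lookup_add G.int_pow_mult closed subset_iff)
    also have "\<dots> = ?h p \<otimes>\<^bsub>G\<^esub> ?h q"
      using T by (subst G.finprod_multf) (auto simp: ext[of p ?T] ext[of q ?T] closed subset_iff)
    finally show "?h (p \<otimes>\<^bsub>free_Abelian_group S\<^esub> q) = ?h p \<otimes>\<^bsub>G\<^esub> ?h q"
      by simp
  qed
qed

section \<open>Tensor products\<close>

text \<open>These are the maps that induce homomorphisms on the tensor product.\<close>

definition balanced ::
    "('r, 'k) ring_scheme \<Rightarrow> ('x, 'l) monoid_scheme \<Rightarrow> ('x \<Rightarrow> 'r \<Rightarrow> 'x)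
      \<Rightarrow> ('y, 'n) monoid_scheme \<Rightarrow> ('r \<Rightarrow> 'y \<Rightarrow> 'y) \<Rightarrow> ('g, 'm) monoid_scheme
      \<Rightarrow> ('x \<Rightarrow> 'y \<Rightarrow> 'g) \<Rightarrow> bool" where
  "balanced R U r W l G h \<longleftrightarrow>
    (\<forall>y\<in>carrier W. (\<lambda>x. h x y) \<in> hom U G) \<and> (\<forall>x\<in>carrier U. h x \<in> hom W G)
    \<and> (\<forall>x\<in>carrier U. \<forall>c\<in>carrier R. \<forall>y\<in>carrier W. h (r x c) y = h x (l c y))"

text \<open>Closure of both actions puts the defining relations inside the free abelian group on the
  carriers. The locale serves A \<otimes> A over B and over C as well as S \<otimes> S and E
  \<otimes> S over V.\<close>

locale tensor = U: comm_group U + W: comm_group W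
  for R :: "('r, 'k) ring_scheme"
    and U :: "('x, 'l) monoid_scheme" and r :: "'x \<Rightarrow> 'r \<Rightarrow> 'x"
    and W :: "('y, 'n) monoid_scheme" and l :: "'r \<Rightarrow> 'y \<Rightarrow> 'y" +
  assumes r_closed: "x \<in> carrier U \<Longrightarrow> c \<in> carrier R \<Longrightarrow> r x c \<in> carrier U"
    and l_closed: "y \<in> carrier W \<Longrightarrow> c \<in> carrier R \<Longrightarrow> l c y \<in> carrier W"
begin

abbreviation "F \<equiv> free_Abelian_group (carrier U \<times> carrier W)"
abbreviation "K \<equiv> tensor_kernel R U r W l"
abbreviation "T \<equiv> tensor_product R U r W l"
abbreviation "pure \<equiv> pure_tensor R U r W l"

sublocale F: comm_group F
  by (rule abelian_free_Abelian_group)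

lemma relations_subset: "tensor_relations R U r W l \<subseteq> carrier F"
  by (auto simp: tensor_relations_def r_closed l_closed dest!: subsetD[OF keys_diff])

lemma kernel_subgroup: "subgroup K F"
  unfolding tensor_kernel_def by (rule F.generate_is_subgroup[OF relations_subset])

lemma relation_in_kernel: "p \<in> tensor_relations R U r W l \<Longrightarrow> p \<in> K"
  unfolding tensor_kernel_def by (rule generate.incl)

sublocale normal K F
  by (rule F.subgroup_imp_normal[OF kernel_subgroup])

sublocale T: comm_group T
  unfolding tensor_product_def by (rule F.abelian_FactGroup[OF kernel_subgroup])

lemma coset_hom: "(\<lambda>p. K #>\<^bsub>F\<^esub> p) \<in> hom F T"
  unfolding tensor_product_def by (rule r_coset_hom_Mod)

lemma pure_closed [intro, simp]: "x \<in> carrier U \<Longrightarrow> y \<in> carrier W \<Longrightarrow> pure x y \<in> carrier T"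
  unfolding pure_tensor_def by (rule hom_in_carrier[OF coset_hom]) simp

lemma coset_eqI:
  assumes "p \<in> carrier F" "q \<in> carrier F" "p - q \<in> K"
  shows "K #>\<^bsub>F\<^esub> p = K #>\<^bsub>F\<^esub> q"
proof -
  have "p = (p - q) + q"
    by simp
  then have "p \<in> K #>\<^bsub>F\<^esub> q"
    using assms(3) unfolding r_coset_def mult_free_Abelian_group by blast
  then show ?thesis
    using F.repr_independence[OF _ assms(2) kernel_subgroup] by blast
qed

lemma coset_frag_add:
  assumes "p \<in> carrier F" "q \<in> carrier F"
  shows "K #>\<^bsub>F\<^esub> (p + q) = (K #>\<^bsub>F\<^esub> p) \<otimes>\<^bsub>T\<^esub> (K #>\<^bsub>F\<^esub> q)"
  using hom_mult[OF coset_hom assms] by simp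

lemma keys_frag_add:
  "\<lbrakk>a \<in> S; b \<in> S\<rbrakk> \<Longrightarrow> Poly_Mapping.keys (frag_of a + frag_of b) \<subseteq> S" for a b :: "'x \<times> 'y"
  using Poly_Mapping.keys_add[of "frag_of a" "frag_of b"] by auto

lemma pure_add_left:
  assumes "x \<in> carrier U" "x' \<in> carrier U" "y \<in> carrier W"
  shows "pure (x \<otimes>\<^bsub>U\<^esub> x') y = pure x y \<otimes>\<^bsub>T\<^esub> pure x' y"
proof -
  have "frag_of (x \<otimes>\<^bsub>U\<^esub> x', y) - (frag_of (x, y) + frag_of (x', y)) \<in> K"
    unfolding diff_diff_eq[symmetric]
    by (rule relation_in_kernel) (use assms in \<open>auto simp: tensor_relations_def\<close>)
  then have "K #>\<^bsub>F\<^esub> frag_of (x \<otimes>\<^bsub>U\<^esub> x', y) = K #>\<^bsub>F\<^esub> (frag_of (x, y) + frag_of (x', y))"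
    using assms keys_frag_add by (intro coset_eqI) auto
  then show ?thesis
    using assms by (simp add: pure_tensor_def coset_frag_add)
qed

lemma pure_add_right:
  assumes "x \<in> carrier U" "y \<in> carrier W" "y' \<in> carrier W"
  shows "pure x (y \<otimes>\<^bsub>W\<^esub> y') = pure x y \<otimes>\<^bsub>T\<^esub> pure x y'"
proof -
  have "frag_of (x, y \<otimes>\<^bsub>W\<^esub> y') - (frag_of (x, y) + frag_of (x, y')) \<in> K"
    unfolding diff_diff_eq[symmetric]
    by (rule relation_in_kernel) (use assms in \<open>auto simp: tensor_relations_def\<close>)
  then have "K #>\<^bsub>F\<^esub> frag_of (x, y \<otimes>\<^bsub>W\<^esub> y') = K #>\<^bsub>F\<^esub> (frag_of (x, y) + frag_of (x, y'))"
    using assms keys_frag_add by (intro coset_eqI) auto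
  then show ?thesis
    using assms by (simp add: pure_tensor_def coset_frag_add)
qed

lemma pure_balanced:
  assumes "x \<in> carrier U" "c \<in> carrier R" "y \<in> carrier W"
  shows "pure (r x c) y = pure x (l c y)"
  unfolding pure_tensor_def
  by (rule coset_eqI)
    (use assms in \<open>auto simp: tensor_relations_def r_closed l_closed intro!: relation_in_kernel\<close>)

lemma balanced_pure: "balanced R U r W l T pure"
  by (auto simp: balanced_def pure_add_left pure_add_right pure_balanced intro!: homI)

text \<open>Pure tensors generate: a representative is built from generators by differences, and
  homomorphisms respect these. Nearly all later identities on tensor products are reduced to pure
  tensors in this way.\<close>

lemma hom_eqI:
  assumes "group G" "f \<in> hom T G" "g \<in> hom T G"
    and "\<And>x y. x \<in> carrier U \<Longrightarrow> y \<in> carrier W \<Longrightarrow> f (pure x y) = g (pure x y)"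
    and "q \<in> carrier T"
  shows "f q = g q"
proof -
  interpret G: group G by fact
  interpret f: group_hom T G f using assms(2) by unfold_locales
  interpret g: group_hom T G g using assms(3) by unfold_locales
  obtain p where p: "Poly_Mapping.keys p \<subseteq> carrier U \<times> carrier W" and q: "q = K #>\<^bsub>F\<^esub> p"
    using assms(5) unfolding tensor_product_def carrier_FactGroup by auto
  interpret c: group_hom F T "\<lambda>p. K #>\<^bsub>F\<^esub> p" using coset_hom by unfold_locales
  have "f (K #>\<^bsub>F\<^esub> p) = g (K #>\<^bsub>F\<^esub> p)"
    using p
  proof (induction p rule: free_Abelian_group_induct[consumes 1, case_names 1 2 3])
    case 1
    have "K #>\<^bsub>F\<^esub> 0 = \<one>\<^bsub>T\<^esub>"
      using c.hom_one by simp
    then show ?case by simp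
  next
    case (2 x y)
    have y: "- y = inv\<^bsub>F\<^esub> y" "Poly_Mapping.keys (- y) \<subseteq> carrier U \<times> carrier W"
      using 2 by auto
    have "K #>\<^bsub>F\<^esub> (x - y) = (K #>\<^bsub>F\<^esub> x) \<otimes>\<^bsub>T\<^esub> (K #>\<^bsub>F\<^esub> (- y))"
      using 2 y(2) coset_frag_add[of x "- y"] by simp
    also have "K #>\<^bsub>F\<^esub> (- y) = inv\<^bsub>T\<^esub> (K #>\<^bsub>F\<^esub> y)"
      unfolding y(1) using 2 by (intro c.hom_inv) simp
    finally show ?case
      using 2 c.hom_closed[of x] c.hom_closed[of y] by simp
  next
    case (3 a)
    then show ?case
      using assms(4) by (auto simp: pure_tensor_def)
  qed
  then show ?thesis
    by (simp add: q)
qed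

text \<open>The homomorphism \<Phi> that h induces on the free abelian group kills the tensor
  relations, hence is constant on cosets. So the definite description in \<open>tensor_lift\<close>
  has exactly one candidate.\<close>

lemma
  assumes "comm_group G" "balanced R U r W l G h"
  shows tensor_lift_hom: "tensor_lift G h \<in> hom T G"
    and tensor_lift_pure:
      "\<And>x y. \<lbrakk>x \<in> carrier U; y \<in> carrier W\<rbrakk> \<Longrightarrow> tensor_lift G h (pure x y) = h x y"
proof -
  interpret G: comm_group G by fact
  define \<Phi> where "\<Phi> = (\<lambda>p :: 'x \<times> 'y \<Rightarrow>\<^sub>0 int. finprod G (\<lambda>z. case_prod h z [^]\<^bsub>G\<^esub> Poly_Mapping.lookup p z)
    (Poly_Mapping.keys p))"
  have closed: "h x y \<in> carrier G" if "x \<in> carrier U" "y \<in> carrier W" for x y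
    using assms(2) that by (auto simp: balanced_def hom_def)
  have \<Phi>: "\<Phi> \<in> hom F G"
    unfolding \<Phi>_def by (rule free_Abelian_group_hom_finprod) (use assms closed in auto)
  interpret \<Phi>: group_hom F G \<Phi> using \<Phi> by unfold_locales
  have \<Phi>_frag: "\<Phi> (frag_of (x, y)) = h x y" if "x \<in> carrier U" "y \<in> carrier W" for x y
    using closed[OF that] by (simp add: \<Phi>_def)
  have \<Phi>_add: "\<Phi> (p + q) = \<Phi> p \<otimes>\<^bsub>G\<^esub> \<Phi> q" if "p \<in> carrier F" "q \<in> carrier F" for p q
    using \<Phi>.hom_mult[OF that] by simp
  \<comment> \<open>Each relation is a difference once the two subtracted generators are grouped by
    \<open>diff_diff_eq\<close>, so it suffices to compare the values of \<Phi> at both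
    ends.\<close>
  have ker: "p - q \<in> kernel F G \<Phi>"
    if "p \<in> carrier F" "q \<in> carrier F" "\<Phi> p = \<Phi> q" for p q
  proof -
    have q: "- q = inv\<^bsub>F\<^esub> q" "Poly_Mapping.keys (- q) \<subseteq> carrier U \<times> carrier W"
      using that by auto
    have "\<Phi> (p - q) = \<Phi> p \<otimes>\<^bsub>G\<^esub> \<Phi> (inv\<^bsub>F\<^esub> q)"
      using \<Phi>_add[of p "- q"] that q by simp
    also have "\<Phi> (inv\<^bsub>F\<^esub> q) = inv\<^bsub>G\<^esub> \<Phi> q"
      by (rule \<Phi>.hom_inv[OF that(2)])
    also have "\<Phi> p \<otimes>\<^bsub>G\<^esub> inv\<^bsub>G\<^esub> \<Phi> q = \<one>\<^bsub>G\<^esub>"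
      using that \<Phi>.hom_closed[OF that(2)] by simp
    finally show ?thesis
      using that keys_diff[of p q] by (auto simp: kernel_def)
  qed
  have "p \<in> kernel F G \<Phi>" if "p \<in> tensor_relations R U r W l" for p
    using that unfolding tensor_relations_def
  proof (elim UnE CollectE exE conjE)
    fix x x' y assume *: "x \<in> carrier U" "x' \<in> carrier U" "y \<in> carrier W"
      and p: "p = frag_of (x \<otimes>\<^bsub>U\<^esub> x', y) - frag_of (x, y) - frag_of (x', y)"
    have "h (x \<otimes>\<^bsub>U\<^esub> x') y = h x y \<otimes>\<^bsub>G\<^esub> h x' y"
      using assms(2) * by (simp add: balanced_def hom_def)
    with * show ?thesis
      unfolding p diff_diff_eq by (intro ker) (auto simp: \<Phi>_add \<Phi>_frag dest!: subsetD[OF Poly_Mapping.keys_add])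
  next
    fix x y y' assume *: "x \<in> carrier U" "y \<in> carrier W" "y' \<in> carrier W"
      and p: "p = frag_of (x, y \<otimes>\<^bsub>W\<^esub> y') - frag_of (x, y) - frag_of (x, y')"
    have "h x (y \<otimes>\<^bsub>W\<^esub> y') = h x y \<otimes>\<^bsub>G\<^esub> h x y'"
      using assms(2) * by (simp add: balanced_def hom_def)
    with * show ?thesis
      unfolding p diff_diff_eq by (intro ker) (auto simp: \<Phi>_add \<Phi>_frag dest!: subsetD[OF Poly_Mapping.keys_add])
  next
    fix x c y assume *: "x \<in> carrier U" "c \<in> carrier R" "y \<in> carrier W"
      and p: "p = frag_of (r x c, y) - frag_of (x, l c y)"
    have "h (r x c) y = h x (l c y)"
      using assms(2) * by (simp add: balanced_def)
    with * show ?thesis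
      unfolding p by (intro ker) (auto simp: \<Phi>_frag r_closed l_closed)
  qed
  then have "tensor_relations R U r W l \<subseteq> kernel F G \<Phi>"
    by blast
  then have K: "K \<subseteq> kernel F G \<Phi>"
    unfolding tensor_kernel_def by (rule F.generate_subgroup_incl[OF _ \<Phi>.subgroup_kernel])
  \<comment> \<open>Two representatives differ by an element of K, on which \<Phi> is
    trivial.\<close>
  have lift: "tensor_lift G h (K #>\<^bsub>F\<^esub> p) = \<Phi> p" if p: "p \<in> carrier F" for p
  proof -
    have eq: "\<Phi> p' = \<Phi> p" if p': "p' \<in> K #>\<^bsub>F\<^esub> p" for p'
    proof -
      obtain k where k: "k \<in> K" "p' = k \<otimes>\<^bsub>F\<^esub> p"
        using p' by (auto simp: r_coset_def)
      have "\<Phi> p' = \<Phi> k \<otimes>\<^bsub>G\<^esub> \<Phi> p"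
        unfolding k(2) using k(1) K p by (intro \<Phi>.hom_mult) (auto simp: kernel_def)
      then show ?thesis
        using k(1) K p by (auto simp: kernel_def)
    qed
    have "(THE z. \<exists>p'\<in>K #>\<^bsub>F\<^esub> p. z = \<Phi> p') = \<Phi> p"
    proof (rule the_equality)
      show "\<exists>p'\<in>K #>\<^bsub>F\<^esub> p. \<Phi> p = \<Phi> p'"
        by (rule bexI[OF refl F.rcos_self[OF p kernel_subgroup]])
    qed (elim bexE, simp only: eq)
    moreover have "\<Phi> = (\<lambda>p. finprod G (\<lambda>(x, y). h x y [^]\<^bsub>G\<^esub> Poly_Mapping.lookup p (x, y))
        (Poly_Mapping.keys p))"
      by (simp add: \<Phi>_def fun_eq_iff case_prod_beta')
    ultimately show ?thesis
      by (simp add: tensor_lift_def)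
  qed
  show "tensor_lift G h (pure x y) = h x y" if "x \<in> carrier U" "y \<in> carrier W" for x y
    unfolding pure_tensor_def using that by (subst lift) (auto simp: \<Phi>_frag)
  show "tensor_lift G h \<in> hom T G"
  proof (rule homI)
    fix q assume "q \<in> carrier T"
    then obtain p where p: "p \<in> carrier F" "q = K #>\<^bsub>F\<^esub> p"
      unfolding tensor_product_def carrier_FactGroup by blast
    then show "tensor_lift G h q \<in> carrier G"
      by (simp only: lift \<Phi>.hom_closed)
  next
    fix q q' assume "q \<in> carrier T" "q' \<in> carrier T"
    then obtain p p' where p: "p \<in> carrier F" "q = K #>\<^bsub>F\<^esub> p" "p' \<in> carrier F" "q' = K #>\<^bsub>F\<^esub> p'"
      unfolding tensor_product_def carrier_FactGroup by blast
    have "q \<otimes>\<^bsub>T\<^esub> q' = K #>\<^bsub>F\<^esub> (p \<otimes>\<^bsub>F\<^esub> p')"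
      unfolding p(2,4) by (rule hom_mult[OF coset_hom p(1,3), symmetric])
    then show "tensor_lift G h (q \<otimes>\<^bsub>T\<^esub> q') = tensor_lift G h q \<otimes>\<^bsub>G\<^esub> tensor_lift G h q'"
      unfolding p(2,4) lift[OF p(1)] lift[OF p(3)] using lift[OF F.m_closed[OF p(1,3)]] \<Phi>.hom_mult[OF p(1,3)]
      by metis
  qed
qed

end

section \<open>Direct summands and dual bases\<close>

text \<open>Turns the internal decomposition into a retraction: f is the embedding, g the projection
  along L followed by the inverse of f. Stability of L under the operators makes g
  equivariant.\<close>

lemma iso_direct_summandE:
  assumes "comm_group M" "comm_group N" "iso_direct_summand \<Omega> M actM N actN"
    and actM_closed: "\<And>w x. \<lbrakk>w \<in> \<Omega>; x \<in> carrier M\<rbrakk> \<Longrightarrow> actM w x \<in> carrier M"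
    and actN_hom: "\<And>w. w \<in> \<Omega> \<Longrightarrow> actN w \<in> hom N N"
  obtains f g where "f \<in> hom M N" "g \<in> hom N M"
    "\<And>w x. \<lbrakk>w \<in> \<Omega>; x \<in> carrier M\<rbrakk> \<Longrightarrow> f (actM w x) = actN w (f x)"
    "\<And>w x. \<lbrakk>w \<in> \<Omega>; x \<in> carrier N\<rbrakk> \<Longrightarrow> g (actN w x) = actM w (g x)"
    "\<And>x. x \<in> carrier M \<Longrightarrow> g (f x) = x"
proof -
  interpret M: comm_group M by fact
  interpret N: comm_group N by fact
  obtain K L f where KL: "subgroup K N" "subgroup L N"
      "\<And>w. w \<in> \<Omega> \<Longrightarrow> actN w ` K \<subseteq> K" "\<And>w. w \<in> \<Omega> \<Longrightarrow> actN w ` L \<subseteq> L"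
      "K \<inter> L = {\<one>\<^bsub>N\<^esub>}" "K <#>\<^bsub>N\<^esub> L = carrier N"
    and f: "f \<in> iso M (N\<lparr>carrier := K\<rparr>)"
      "\<And>w x. \<lbrakk>w \<in> \<Omega>; x \<in> carrier M\<rbrakk> \<Longrightarrow> f (actM w x) = actN w (f x)"
    using assms(3) unfolding iso_direct_summand_def by metis
  interpret K: subgroup K N by fact
  interpret L: subgroup L N by fact
  have fK: "f x \<in> K" if "x \<in> carrier M" for x
    using f(1) that by (auto simp: iso_def hom_def)
  have f_hom: "f \<in> hom M N"
    using f(1) K.subset by (auto simp: iso_def hom_def)
  \<comment> \<open>The graph of the projection: totality comes from the sum of K and L being
    everything, single-valuedness from their trivial intersection.\<close>
  define P where "P n x \<longleftrightarrow> x \<in> carrier M \<and> (\<exists>l\<in>L. n = f x \<otimes>\<^bsub>N\<^esub> l)" for n x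
  have ex: "\<exists>x. P n x" if n: "n \<in> carrier N" for n
  proof -
    have "n \<in> K <#>\<^bsub>N\<^esub> L"
      using n KL(6) by simp
    then obtain k l where "k \<in> K" "l \<in> L" "n = k \<otimes>\<^bsub>N\<^esub> l"
      unfolding set_mult_def by auto
    moreover obtain x where "x \<in> carrier M" "k = f x"
      using f(1) \<open>k \<in> K\<close> by (auto simp: iso_def bij_betw_def)
    ultimately show ?thesis
      by (auto simp: P_def)
  qed
  have unique: "x = x'" if "P n x" "P n x'" for n x x'
  proof -
    obtain l l' where l: "x \<in> carrier M" "x' \<in> carrier M" "l \<in> L" "l' \<in> L"
        "f x \<otimes>\<^bsub>N\<^esub> l = f x' \<otimes>\<^bsub>N\<^esub> l'"
      using \<open>P n x\<close> \<open>P n x'\<close> by (auto simp: P_def)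
    \<comment> \<open>This element measures the difference of the two K-components and, by the
      equation, also that of the L-components, so it lies in both subgroups.\<close>
    define d where "d = inv\<^bsub>N\<^esub> f x' \<otimes>\<^bsub>N\<^esub> f x"
    have c: "f x \<in> carrier N" "f x' \<in> carrier N" "l \<in> carrier N" "l' \<in> carrier N"
      using fK l by auto
    have "d = inv\<^bsub>N\<^esub> f x' \<otimes>\<^bsub>N\<^esub> (f x \<otimes>\<^bsub>N\<^esub> l) \<otimes>\<^bsub>N\<^esub> inv\<^bsub>N\<^esub> l"
      using c by (simp add: d_def N.m_assoc)
    also have "\<dots> = l' \<otimes>\<^bsub>N\<^esub> inv\<^bsub>N\<^esub> l"
      unfolding l(5) using c by (simp add: N.m_assoc[symmetric])
    finally have "d \<in> L"
      using l by simp
    moreover have "d \<in> K"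
      unfolding d_def using fK l by simp
    ultimately have "inv\<^bsub>N\<^esub> f x' \<otimes>\<^bsub>N\<^esub> f x = \<one>\<^bsub>N\<^esub>"
      using KL(5) d_def by auto
    then have "f x = f x'"
      using c by (metis N.inv_solve_left N.r_one N.one_closed)
    then show ?thesis
      using f(1) l(1,2) by (auto simp: iso_def bij_betw_def inj_on_def)
  qed
  obtain g where g: "\<And>n. n \<in> carrier N \<Longrightarrow> P n (g n)"
    using ex by metis
  have gI: "g n = x" if "n \<in> carrier N" "P n x" for n x
    using unique g that by blast
  show thesis
  proof
    show "g \<in> hom N M"
    proof (rule homI)
      fix n n' assume n: "n \<in> carrier N" "n' \<in> carrier N"
      obtain l l' where l: "g n \<in> carrier M" "g n' \<in> carrier M" "l \<in> L" "l' \<in> L"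
          "n = f (g n) \<otimes>\<^bsub>N\<^esub> l" "n' = f (g n') \<otimes>\<^bsub>N\<^esub> l'"
        using g[OF n(1)] g[OF n(2)] by (auto simp: P_def)
      have "n \<otimes>\<^bsub>N\<^esub> n' = (f (g n) \<otimes>\<^bsub>N\<^esub> l) \<otimes>\<^bsub>N\<^esub> (f (g n') \<otimes>\<^bsub>N\<^esub> l')"
        using l(5,6) by simp
      also have "\<dots> = (f (g n) \<otimes>\<^bsub>N\<^esub> f (g n')) \<otimes>\<^bsub>N\<^esub> (l \<otimes>\<^bsub>N\<^esub> l')"
        using fK l(1-4) by (simp add: N.m_ac)
      also have "f (g n) \<otimes>\<^bsub>N\<^esub> f (g n') = f (g n \<otimes>\<^bsub>M\<^esub> g n')"
        using hom_mult[OF f_hom] l(1,2) by simp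
      finally have "P (n \<otimes>\<^bsub>N\<^esub> n') (g n \<otimes>\<^bsub>M\<^esub> g n')"
        using l(1-4) by (auto simp: P_def)
      then show "g (n \<otimes>\<^bsub>N\<^esub> n') = g n \<otimes>\<^bsub>M\<^esub> g n'"
        using n by (intro gI) auto
    qed (use g P_def in auto)
    show "g (actN w n) = actM w (g n)" if wn: "w \<in> \<Omega>" "n \<in> carrier N" for w n
    proof -
      obtain l where l: "g n \<in> carrier M" "l \<in> L" "n = f (g n) \<otimes>\<^bsub>N\<^esub> l"
        using g[OF wn(2)] by (auto simp: P_def)
      have "actN w n = actN w (f (g n)) \<otimes>\<^bsub>N\<^esub> actN w l"
        using l(3) hom_mult[OF actN_hom[OF wn(1)], of "f (g n)" l] fK[OF l(1)] l(2) by simp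
      moreover have "actN w l \<in> L"
        using KL(4)[OF wn(1)] l(2) by blast
      ultimately have "P (actN w n) (actM w (g n))"
        using l(1) f(2) wn(1) actM_closed unfolding P_def by auto
      then show ?thesis
        using hom_in_carrier[OF actN_hom[OF wn(1)] wn(2)] by (rule gI[rotated])
    qed
    show "g (f x) = x" if "x \<in> carrier M" for x
      using that fK[OF that] by (intro gI) (auto simp: P_def intro!: bexI[of _ "\<one>\<^bsub>N\<^esub>"])
  qed (use f_hom f(2) in auto)
qed

text \<open>The complement of the image of f is the kernel of g: an element n splits as f (g n) plus
  a remainder, and g kills the remainder because g is a left inverse of f.\<close>

lemma iso_direct_summandI:
  assumes "comm_group M" "comm_group N" "f \<in> hom M N" "g \<in> hom N M"
    and f: "\<And>w x. \<lbrakk>w \<in> \<Omega>; x \<in> carrier M\<rbrakk> \<Longrightarrow> f (actM w x) = actN w (f x)"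
    and g: "\<And>w x. \<lbrakk>w \<in> \<Omega>; x \<in> carrier N\<rbrakk> \<Longrightarrow> g (actN w x) = actM w (g x)"
    and gf: "\<And>x. x \<in> carrier M \<Longrightarrow> g (f x) = x"
    and actM_hom: "\<And>w. w \<in> \<Omega> \<Longrightarrow> actM w \<in> hom M M"
    and actN_closed: "\<And>w x. \<lbrakk>w \<in> \<Omega>; x \<in> carrier N\<rbrakk> \<Longrightarrow> actN w x \<in> carrier N"
  shows "iso_direct_summand \<Omega> M actM N actN"
proof -
  interpret M: comm_group M by fact
  interpret N: comm_group N by fact
  interpret f: group_hom M N f using assms(3) by unfold_locales
  interpret g: group_hom N M g using assms(4) by unfold_locales
  let ?K = "f ` carrier M" and ?L = "kernel N M g"
  have K: "subgroup ?K N"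
    by (rule f.img_is_subgroup)
  have L: "subgroup ?L N"
    by (rule g.subgroup_kernel)
  have "actN w x \<in> ?K" if "w \<in> \<Omega>" "x \<in> ?K" for w x
    using that f[symmetric] hom_in_carrier[OF actM_hom] by auto
  moreover have "actN w x \<in> ?L" if w: "w \<in> \<Omega>" and x: "x \<in> ?L" for w x
  proof -
    interpret a: group_hom M M "actM w" using actM_hom[OF w] by unfold_locales
    show ?thesis
      using w x g actN_closed by (auto simp: kernel_def)
  qed
  moreover have "?K \<inter> ?L = {\<one>\<^bsub>N\<^esub>}"
  proof -
    have "\<one>\<^bsub>N\<^esub> \<in> ?K \<inter> ?L"
      using subgroup.one_closed[OF K] subgroup.one_closed[OF L] by simp
    moreover have "y = \<one>\<^bsub>N\<^esub>" if "y \<in> ?K \<inter> ?L" for y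
      using that gf by (auto simp: kernel_def)
    ultimately show ?thesis
      by blast
  qed
  moreover have "?K <#>\<^bsub>N\<^esub> ?L = carrier N"
  proof
    show "?K <#>\<^bsub>N\<^esub> ?L \<subseteq> carrier N"
      using N.set_mult_closed[OF subgroup.subset[OF K] subgroup.subset[OF L]] .
    show "carrier N \<subseteq> ?K <#>\<^bsub>N\<^esub> ?L"
    proof
      fix n assume n: "n \<in> carrier N"
      let ?k = "f (g n)" and ?l = "inv\<^bsub>N\<^esub> f (g n) \<otimes>\<^bsub>N\<^esub> n"
      have "?l \<in> ?L"
        using n gf[of "g n"] by (simp add: kernel_def)
      moreover have "n = ?k \<otimes>\<^bsub>N\<^esub> ?l"
        using n by (simp add: N.m_assoc[symmetric])
      moreover have "?k \<in> ?K"
        using n by simp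
      ultimately show "n \<in> ?K <#>\<^bsub>N\<^esub> ?L"
        unfolding set_mult_def by blast
    qed
  qed
  moreover have "f \<in> iso M (N\<lparr>carrier := ?K\<rparr>)"
    using gf by (auto simp: iso_def hom_def bij_betw_def intro!: inj_on_inverseI[of _ g])
  ultimately show ?thesis
    unfolding iso_direct_summand_def using K L f by (intro exI[of _ ?K] exI[of _ ?L] exI[of _ f]) auto
qed

section \<open>Coordinates in finite powers of a ring\<close>

lemma comm_group_product_group:
  assumes "\<And>i. i \<in> I \<Longrightarrow> comm_group (G i)"
  shows "comm_group (product_group I G)"
proof (rule group.group_comm_groupI)
  show "group (product_group I G)"
    using assms by (intro product_group) (auto simp: comm_group_def)
  fix x y assume "x \<in> carrier (product_group I G)" "y \<in> carrier (product_group I G)"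
  then show "x \<otimes>\<^bsub>product_group I G\<^esub> y = y \<otimes>\<^bsub>product_group I G\<^esub> x"
    using assms by (auto intro!: restrict_ext comm_monoid.m_comm simp: comm_group_def)
qed

lemma finprod_product_group:
  assumes "\<And>i. i \<in> I \<Longrightarrow> comm_group (G i)" "f \<in> J \<rightarrow> carrier (product_group I G)" "i \<in> I"
  shows "finprod (product_group I G) f J i = finprod (G i) (\<lambda>j. f j i) J"
  using assms by (intro hom_finprod[where h = "\<lambda>x. x i"] comm_group_product_group homI) auto

text \<open>
  A direct summand of \<open>A\<^sup>N\<close> has a dual basis: coordinate maps \<open>f i\<close> and the images \<open>u i\<close> of the
  unit vectors.  The operator \<open>\<sigma> a\<close> is the one that acts on \<open>A\<close> by sending \<open>1\<close> to \<open>a\<close>.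
\<close>

lemma summand_of_power_dual_basis:
  fixes A :: "('a, 'k) ring_scheme" and n :: nat
  assumes "comm_group M" "ring A"
    and "iso_direct_summand \<Omega> M actM (product_group {..<n} (\<lambda>_. add_monoid A))
      (pointwise_act {..<n} act)"
    and actM_closed: "\<And>w x. \<lbrakk>w \<in> \<Omega>; x \<in> carrier M\<rbrakk> \<Longrightarrow> actM w x \<in> carrier M"
    and act_hom: "\<And>w. w \<in> \<Omega> \<Longrightarrow> act w \<in> hom (add_monoid A) (add_monoid A)"
    and \<sigma>: "\<And>a. a \<in> carrier A \<Longrightarrow> \<sigma> a \<in> \<Omega>" "\<And>a. a \<in> carrier A \<Longrightarrow> act (\<sigma> a) \<one>\<^bsub>A\<^esub> = a"
  obtains f u where "\<And>i. i < n \<Longrightarrow> f i \<in> hom M (add_monoid A)"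
    "\<And>i w x. \<lbrakk>i < n; w \<in> \<Omega>; x \<in> carrier M\<rbrakk> \<Longrightarrow> f i (actM w x) = act w (f i x)"
    "\<And>i. i < n \<Longrightarrow> u i \<in> carrier M"
    "\<And>i w w'. \<lbrakk>i < n; w \<in> \<Omega>; w' \<in> \<Omega>; act w \<one>\<^bsub>A\<^esub> = act w' \<one>\<^bsub>A\<^esub>\<rbrakk>
      \<Longrightarrow> actM w (u i) = actM w' (u i)"
    "\<And>x. x \<in> carrier M \<Longrightarrow> x = finprod M (\<lambda>i. actM (\<sigma> (f i x)) (u i)) {..<n}"
proof -
  interpret M: comm_group M by fact
  interpret A: ring A by fact
  let ?N = "product_group {..<n} (\<lambda>_. add_monoid A)"
  have A: "comm_group (add_monoid A)"
    by (rule A.a_comm_group)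
  have N: "comm_group ?N"
    using A by (rule comm_group_product_group)
  interpret N: comm_group ?N by fact
  have act_closed: "act w a \<in> carrier A" if "w \<in> \<Omega>" "a \<in> carrier A" for w a
    using hom_in_carrier[OF act_hom[OF that(1)], of a] that by simp
  have act_add: "act w (a \<oplus>\<^bsub>A\<^esub> b) = act w a \<oplus>\<^bsub>A\<^esub> act w b"
    if "w \<in> \<Omega>" "a \<in> carrier A" "b \<in> carrier A" for w a b
    using hom_mult[OF act_hom[OF that(1)], of a b] that by simp
  have act_zero: "act w \<zero>\<^bsub>A\<^esub> = \<zero>\<^bsub>A\<^esub>" if "w \<in> \<Omega>" for w
    using hom_one[OF act_hom[OF that] A.a_group A.a_group] by simp
  have pw_hom: "pointwise_act {..<n} act w \<in> hom ?N ?N" if "w \<in> \<Omega>" for w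
    using that by (auto simp: pointwise_act_def act_closed act_add PiE_iff intro!: homI)
  obtain f g where fg: "f \<in> hom M ?N" "g \<in> hom ?N M"
    "\<And>w x. \<lbrakk>w \<in> \<Omega>; x \<in> carrier M\<rbrakk> \<Longrightarrow> f (actM w x) = pointwise_act {..<n} act w (f x)"
    "\<And>w x. \<lbrakk>w \<in> \<Omega>; x \<in> carrier ?N\<rbrakk> \<Longrightarrow> g (pointwise_act {..<n} act w x) = actM w (g x)"
    "\<And>x. x \<in> carrier M \<Longrightarrow> g (f x) = x"
    by (rule iso_direct_summandE[OF assms(1) N assms(3) actM_closed pw_hom]) blast+
  \<comment> \<open>Every operator fixes 0, so it acts on a unit vector only through its value at
    1.\<close>
  define e where "e i = (\<lambda>j\<in>{..<n}. if i = j then \<one>\<^bsub>A\<^esub> else \<zero>\<^bsub>A\<^esub>)" for i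
  have e: "e i \<in> carrier ?N" for i
    by (auto simp: e_def)
  have pw_closed: "pointwise_act {..<n} act w x \<in> carrier ?N"
    if "w \<in> \<Omega>" "x \<in> carrier ?N" for w x
    by (rule hom_in_carrier[OF pw_hom[OF that(1)] that(2)])
  have f_closed: "f x \<in> carrier ?N" if "x \<in> carrier M" for x
    by (rule hom_in_carrier[OF fg(1) that])
  have f_coord: "f x i \<in> carrier A" if "x \<in> carrier M" "i < n" for x i
    using f_closed[OF that(1)] that(2) by auto
  have decomp: "f x = finprod ?N (\<lambda>i. pointwise_act {..<n} act (\<sigma> (f x i)) (e i)) {..<n}"
    (is "_ = finprod ?N ?F _") if x: "x \<in> carrier M" for x
  proof -
    have F: "?F \<in> {..<n} \<rightarrow> carrier ?N"
      using x e by (auto intro!: pw_closed \<sigma> f_coord simp del: carrier_product_group)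
    have "f x j = finprod ?N ?F {..<n} j" if j: "j < n" for j
    proof -
      have "finprod ?N ?F {..<n} j = finsum A (\<lambda>i. ?F i j) {..<n}"
        unfolding finsum_def by (rule finprod_product_group) (use A F j in auto)
      \<comment> \<open>In coordinate j only the term i = j survives; there the operator takes 1 to
        \<open>f x i\<close> by the choice of \<sigma>.\<close>
      also have "\<dots> = finsum A (\<lambda>i. if j = i then f x i else \<zero>\<^bsub>A\<^esub>) {..<n}"
        using x j by (intro A.add.finprod_cong')
          (auto simp: pointwise_act_def e_def f_coord \<sigma> act_zero)
      also have "\<dots> = f x j"
        using x j A.add.finprod_singleton[of j "{..<n}" "f x"] by (simp add: f_coord)
      finally show ?thesis ..
    qed
    moreover have "f x \<in> extensional {..<n}" "finprod ?N ?F {..<n} \<in> extensional {..<n}"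
      using f_closed[OF x] N.finprod_closed[OF F] by (auto simp: PiE_def)
    ultimately show ?thesis
      by (intro extensionalityI[of _ "{..<n}"]) auto
  qed
  show thesis
  proof
    show "(\<lambda>x. f x i) \<in> hom M (add_monoid A)" if "i < n" for i
      using that by (auto intro!: homI simp: f_coord hom_mult[OF fg(1)])
    show "f (actM w x) i = act w (f x i)" if "i < n" "w \<in> \<Omega>" "x \<in> carrier M" for i w x
      using that by (simp add: fg(3) pointwise_act_def)
    show "g (e i) \<in> carrier M" if "i < n" for i
      by (rule hom_in_carrier[OF fg(2) e])
    show "actM w (g (e i)) = actM w' (g (e i))"
      if "i < n" "w \<in> \<Omega>" "w' \<in> \<Omega>" "act w \<one>\<^bsub>A\<^esub> = act w' \<one>\<^bsub>A\<^esub>" for i w w'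
    proof -
      \<comment> \<open>Applied to left multiplication by the image of c and right multiplication by
        the same element, which agree at 1, this is what later places the generators in the
        centralizer.\<close>
      have "pointwise_act {..<n} act w (e i) = pointwise_act {..<n} act w' (e i)"
        using that by (auto simp: pointwise_act_def e_def act_zero)
      then show ?thesis
        using fg(4)[OF that(2) e] fg(4)[OF that(3) e] by metis
    qed
    show "x = finprod M (\<lambda>i. actM (\<sigma> (f x i)) (g (e i))) {..<n}" if x: "x \<in> carrier M" for x
    proof -
      have "x = g (f x)"
        using fg(5) x by simp
      also have "\<dots> = finprod M (\<lambda>i. g (pointwise_act {..<n} act (\<sigma> (f x i)) (e i))) {..<n}"
        using x e by (subst decomp[OF x], intro hom_finprod[OF N assms(1) fg(2)])
          (auto intro!: pw_closed \<sigma> f_coord simp del: carrier_product_group)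
      also have "\<dots> = finprod M (\<lambda>i. actM (\<sigma> (f x i)) (g (e i))) {..<n}"
        using x e fg(2)
        by (intro M.finprod_cong')
          (auto simp: fg(4) \<sigma> f_coord simp del: carrier_product_group
            intro!: actM_closed hom_in_carrier[OF fg(2)])
      finally show ?thesis .
    qed
  qed
qed

lemma (in left_module) act_hom_right:
  "r \<in> carrier R \<Longrightarrow> act r \<in> hom M M"
  by (auto intro!: homI act_closed act_add_right)

lemma (in left_module) act_hom_left:
  "x \<in> carrier M \<Longrightarrow> (\<lambda>r. act r x) \<in> hom (add_monoid R) M"
  by (auto intro!: homI act_closed act_add_left)

text \<open>
  In \<^const>\<open>projective_module\<close> the free module is indexed by elements of \<open>M\<close>, so repeated
  generators are merged by adding their coordinate functionals.
\<close>

lemma (in left_module) dual_basis_imp_fgp: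
  assumes "finite I" and u: "\<And>i. i \<in> I \<Longrightarrow> u i \<in> carrier M"
    and f: "\<And>i. i \<in> I \<Longrightarrow> f i \<in> hom M (add_monoid R)"
    and f_act: "\<And>i r x. \<lbrakk>i \<in> I; r \<in> carrier R; x \<in> carrier M\<rbrakk>
      \<Longrightarrow> f i (act r x) = r \<otimes>\<^bsub>R\<^esub> f i x"
    and dual: "\<And>x. x \<in> carrier M \<Longrightarrow> x = finprod M (\<lambda>i. act (f i x) (u i)) I"
  shows "fgp_left_module R M act"
proof -
  let ?U = "u ` I" and ?fib = "\<lambda>y. {i \<in> I. u i = y}"
  define c where "c y x = finsum R (\<lambda>i. f i x) (?fib y)" for y x
  have M: "comm_group M" ..
  have R: "comm_group (add_monoid R)"
    by (rule R.a_comm_group)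
  have fin: "finite ?U" "?U \<subseteq> carrier M"
    using assms(1) u by auto
  have f_closed: "f i x \<in> carrier R" if "i \<in> I" "x \<in> carrier M" for i x
    using hom_in_carrier[OF f[OF that(1)] that(2)] by simp
  have c_hom: "c y \<in> hom M (add_monoid R)" for y
    unfolding c_def finsum_def by (rule finprod_hom[OF R]) (use f in auto)
  have c_closed: "c y x \<in> carrier R" if "x \<in> carrier M" for y x
    using hom_in_carrier[OF c_hom that] by simp
  have c_act: "c y (act r x) = r \<otimes>\<^bsub>R\<^esub> c y x" if "r \<in> carrier R" "x \<in> carrier M" for y r x
  proof -
    have "c y (act r x) = finsum R (\<lambda>i. r \<otimes>\<^bsub>R\<^esub> f i x) (?fib y)"
      unfolding c_def using that by (intro R.add.finprod_cong') (auto simp: f_act f_closed)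
    also have "\<dots> = r \<otimes>\<^bsub>R\<^esub> c y x"
      unfolding c_def using that assms(1) by (intro R.finsum_rdistr[symmetric]) (auto simp: f_closed)
    finally show ?thesis .
  qed
  have dual': "x = finprod M (\<lambda>y. act (c y x) y) ?U" if x: "x \<in> carrier M" for x
  proof -
    have "x = finprod M (\<lambda>i. act (f i x) (u i)) (\<Union>y\<in>?U. ?fib y)"
      using dual[OF x] by (rule back_subst[of "\<lambda>J. x = finprod M _ J"]) auto
    also have "\<dots> = finprod M (\<lambda>y. finprod M (\<lambda>i. act (f i x) (u i)) (?fib y)) ?U"
      using assms(1) x
      by (intro M.finprod_UN_disjoint) (auto simp: pairwise_def disjnt_def intro!: act_closed f_closed u)
    also have "\<dots> = finprod M (\<lambda>y. act (c y x) y) ?U"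
    proof (intro M.finprod_cong')
      fix y assume y: "y \<in> ?U"
      have "act (c y x) y = finprod M (\<lambda>i. act (f i x) y) (?fib y)"
        unfolding c_def finsum_def using y x fin
        by (intro hom_finprod[OF R M act_hom_left]) (auto simp: f_closed u)
      also have "\<dots> = finprod M (\<lambda>i. act (f i x) (u i)) (?fib y)"
        using x by (intro M.finprod_cong') (auto simp: f_closed u act_closed)
      finally show "finprod M (\<lambda>i. act (f i x) (u i)) (?fib y) = act (c y x) y" ..
    qed (use x fin in \<open>auto intro!: act_closed c_closed\<close>)
    finally show ?thesis .
  qed
  have "fin_gen_module R M act"
    unfolding fin_gen_module_def using fin
  proof (intro exI[of _ ?U] conjI ballI)
    fix x assume "x \<in> carrier M"
    then show "\<exists>d\<in>?U \<rightarrow> carrier R. x = finprod M (\<lambda>y. act (d y) y) ?U"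
      using dual' by (intro bexI[of _ "\<lambda>y. c y x"]) (auto simp: c_closed)
  qed
  moreover have "projective_module R M act"
    unfolding projective_module_def
  proof (rule exI[of _ ?U])
    let ?S = "sum_group ?U (\<lambda>_. add_monoid R)"
    have grp: "group (add_monoid R)"
      by (rule R.a_group)
    \<comment> \<open>The set of generators is finite, so the restricted direct sum is the full
      product.\<close>
    have S_carrier: "carrier ?S = (?U \<rightarrow>\<^sub>E carrier R)"
      using assms(1) grp by (subst carrier_sum_group) auto
    have S: "comm_group ?S"
      by (rule group.group_comm_groupI[OF sum_group[OF grp]])
        (auto simp: S_carrier fun_eq_iff PiE_mem intro!: R.a_comm)
    have s_closed: "act (s y) y \<in> carrier M" if "s \<in> carrier ?S" "y \<in> ?U" for s y
      using that fin by (intro act_closed) (auto simp: S_carrier simp del: image_eqI)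
    show "iso_direct_summand (carrier R) M act ?S (pointwise_act ?U (\<otimes>\<^bsub>R\<^esub>))"
    proof (rule iso_direct_summandI[OF M S])
      \<comment> \<open>The retraction consists of the coordinate map into the free module and of
        the linear combination map back; the dual basis identity says that their composite is the
        identity.\<close>
      show "(\<lambda>x. \<lambda>y\<in>?U. c y x) \<in> hom M ?S"
        using c_hom by (auto intro!: homI simp: S_carrier c_closed hom_def)
      show "(\<lambda>s. finprod M (\<lambda>y. act (s y) y) ?U) \<in> hom ?S M"
      proof (rule finprod_hom[OF M], rule homI)
        fix y s s' assume *: "y \<in> ?U" "s \<in> carrier ?S" "s' \<in> carrier ?S"
        have "(s \<otimes>\<^bsub>?S\<^esub> s') y = s y \<oplus>\<^bsub>R\<^esub> s' y"
          using *(1) by simp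
        then show "act ((s \<otimes>\<^bsub>?S\<^esub> s') y) y = act (s y) y \<otimes>\<^bsub>M\<^esub> act (s' y) y"
          using * fin by (simp only:) (rule act_add_left, auto simp: S_carrier)
      qed (rule s_closed)
      show "(\<lambda>y\<in>?U. c y (act r x)) = pointwise_act ?U (\<otimes>\<^bsub>R\<^esub>) r (\<lambda>y\<in>?U. c y x)"
        if "r \<in> carrier R" "x \<in> carrier M" for r x
        using that by (auto simp: pointwise_act_def c_act)
      show "finprod M (\<lambda>y. act (pointwise_act ?U (\<otimes>\<^bsub>R\<^esub>) r s y) y) ?U
          = act r (finprod M (\<lambda>y. act (s y) y) ?U)"
        if r: "r \<in> carrier R" and s: "s \<in> carrier ?S" for r s
      proof -
        have "act r (finprod M (\<lambda>y. act (s y) y) ?U) = finprod M (\<lambda>y. act r (act (s y) y)) ?U"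
          using r s s_closed by (intro hom_finprod[OF M M act_hom_right]) auto
        also have "\<dots> = finprod M (\<lambda>y. act (pointwise_act ?U (\<otimes>\<^bsub>R\<^esub>) r s y) y) ?U"
        proof (intro M.finprod_cong')
          fix y assume y: "y \<in> ?U"
          then have "s y \<in> carrier R"
            using s by (auto simp: S_carrier)
          then show "act r (act (s y) y) = act (pointwise_act ?U (\<otimes>\<^bsub>R\<^esub>) r s y) y"
            using y r fin(2) unfolding pointwise_act_def by (simp add: act_mult subset_iff)
        next
          have "pointwise_act ?U (\<otimes>\<^bsub>R\<^esub>) r s \<in> carrier ?S"
            using r s by (auto simp: S_carrier pointwise_act_def)
          then show "(\<lambda>y. act (pointwise_act ?U (\<otimes>\<^bsub>R\<^esub>) r s y) y) \<in> ?U \<rightarrow> carrier M"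
            using s_closed by blast
        qed simp
        finally show ?thesis ..
      qed
      show "finprod M (\<lambda>y. act ((\<lambda>y\<in>?U. c y x) y) y) ?U = x" if x: "x \<in> carrier M" for x
      proof -
        have "finprod M (\<lambda>y. act ((\<lambda>y\<in>?U. c y x) y) y) ?U = finprod M (\<lambda>y. act (c y x) y) ?U"
          using x fin by (intro M.finprod_cong') (auto intro!: act_closed c_closed)
        then show ?thesis
          using dual'[OF x] by simp
      qed
      show "pointwise_act ?U (\<otimes>\<^bsub>R\<^esub>) r s \<in> carrier ?S" if "r \<in> carrier R" "s \<in> carrier ?S" for r s
        using that by (auto simp: S_carrier pointwise_act_def)
    qed (rule act_hom_right)
  qed
  ultimately show ?thesis
    unfolding fgp_left_module_def using left_module_axioms by simp
qed

section \<open>Endomorphism rings, centralizers and opposite rings\<close>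

lemma bimod_End_closed:
  "f \<in> carrier (bimod_End A R \<rho> T \<tau>) \<Longrightarrow> a \<in> carrier A \<Longrightarrow> f a \<in> carrier A"
  by (auto simp: bimod_End_def hom_def)

lemma bimod_End_add:
  "\<lbrakk>f \<in> carrier (bimod_End A R \<rho> T \<tau>); a \<in> carrier A; b \<in> carrier A\<rbrakk> \<Longrightarrow> f (a \<oplus>\<^bsub>A\<^esub> b) = f a \<oplus>\<^bsub>A\<^esub> f b"
  by (auto simp: bimod_End_def hom_def)

lemma bimod_End_left:
  "\<lbrakk>f \<in> carrier (bimod_End A R \<rho> T \<tau>); r \<in> carrier R; a \<in> carrier A\<rbrakk>
    \<Longrightarrow> f (\<rho> r \<otimes>\<^bsub>A\<^esub> a) = \<rho> r \<otimes>\<^bsub>A\<^esub> f a"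
  by (auto simp: bimod_End_def)

lemma bimod_End_right:
  "\<lbrakk>f \<in> carrier (bimod_End A R \<rho> T \<tau>); t \<in> carrier T; a \<in> carrier A\<rbrakk>
    \<Longrightarrow> f (a \<otimes>\<^bsub>A\<^esub> \<tau> t) = f a \<otimes>\<^bsub>A\<^esub> \<tau> t"
  by (auto simp: bimod_End_def)

lemma bimod_End_extensional:
  "f \<in> carrier (bimod_End A R \<rho> T \<tau>) \<Longrightarrow> f \<in> extensional (carrier A)"
  by (auto simp: bimod_End_def)

lemma bimod_EndI:
  assumes "\<And>a. a \<in> carrier A \<Longrightarrow> f a \<in> carrier A"
    and "\<And>a b. \<lbrakk>a \<in> carrier A; b \<in> carrier A\<rbrakk> \<Longrightarrow> f (a \<oplus>\<^bsub>A\<^esub> b) = f a \<oplus>\<^bsub>A\<^esub> f b"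
    and "\<And>r a. \<lbrakk>r \<in> carrier R; a \<in> carrier A\<rbrakk> \<Longrightarrow> f (\<rho> r \<otimes>\<^bsub>A\<^esub> a) = \<rho> r \<otimes>\<^bsub>A\<^esub> f a"
    and "\<And>t a. \<lbrakk>t \<in> carrier T; a \<in> carrier A\<rbrakk> \<Longrightarrow> f (a \<otimes>\<^bsub>A\<^esub> \<tau> t) = f a \<otimes>\<^bsub>A\<^esub> \<tau> t"
    and "f \<in> extensional (carrier A)"
  shows "f \<in> carrier (bimod_End A R \<rho> T \<tau>)"
  using assms by (auto simp: bimod_End_def hom_def)

lemma bimod_End_simps [simp]:
  "f \<otimes>\<^bsub>bimod_End A R \<rho> T \<tau>\<^esub> g = compose (carrier A) f g"
  "\<one>\<^bsub>bimod_End A R \<rho> T \<tau>\<^esub> = (\<lambda>a\<in>carrier A. a)"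
  "f \<oplus>\<^bsub>bimod_End A R \<rho> T \<tau>\<^esub> g = (\<lambda>a\<in>carrier A. f a \<oplus>\<^bsub>A\<^esub> g a)"
  "\<zero>\<^bsub>bimod_End A R \<rho> T \<tau>\<^esub> = (\<lambda>a\<in>carrier A. \<zero>\<^bsub>A\<^esub>)"
  by (simp_all add: bimod_End_def)

text \<open>All these endomorphism rings share their operations and differ only in the carrier.
  Hence E is literally S with a smaller carrier, which identifies the ring in the coideal condition
  with E.\<close>

lemma bimod_End_carrier_update:
  "(bimod_End A R \<rho> T \<tau>)\<lparr>carrier := carrier (bimod_End A R' \<rho>' T' \<tau>')\<rparr> = bimod_End A R' \<rho>' T' \<tau>'"
  by (simp add: bimod_End_def)

lemma bimod_End_eqI:
  assumes "f \<in> carrier (bimod_End A R \<rho> T \<tau>)" "g \<in> carrier (bimod_End A R \<rho> T \<tau>)"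
    and "\<And>a. a \<in> carrier A \<Longrightarrow> f a = g a"
  shows "f = g"
  using assms by (auto intro: extensionalityI[of _ "carrier A"] bimod_End_extensional)

context ring
begin

lemma bimod_End_ring:
  assumes "\<rho> \<in> carrier K \<rightarrow> carrier R" "\<tau> \<in> carrier T \<rightarrow> carrier R"
  shows "ring (bimod_End R K \<rho> T \<tau>)" (is "ring ?E")
proof (rule ringI)
  have c: "\<And>k. k \<in> carrier K \<Longrightarrow> \<rho> k \<in> carrier R" "\<And>t. t \<in> carrier T \<Longrightarrow> \<tau> t \<in> carrier R"
    using assms by auto
  show "abelian_group ?E"
  proof (rule abelian_groupI)
    fix f assume f: "f \<in> carrier ?E"
    have zero: "f \<zero> = \<zero>"
      using bimod_End_add[OF f, of \<zero> \<zero>] f by (metis add.l_cancel_one' bimod_End_closed r_zero zero_closed)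
    have neg: "f (\<ominus> a) = \<ominus> f a" if "a \<in> carrier R" for a
      using bimod_End_add[OF f, of "\<ominus> a" a] f that zero
      by (metis a_inv_closed add.inv_equality bimod_End_closed l_neg)
    have "(\<lambda>a\<in>carrier R. \<ominus> f a) \<in> carrier ?E"
      by (rule bimod_EndI)
        (auto simp: bimod_End_closed[OF f] c bimod_End_add[OF f] bimod_End_left[OF f] bimod_End_right[OF f] minus_add l_minus r_minus)
    moreover have "(\<lambda>a\<in>carrier R. \<ominus> f a) \<oplus>\<^bsub>?E\<^esub> f = \<zero>\<^bsub>?E\<^esub>"
      by (auto simp: l_neg bimod_End_closed[OF f])
    ultimately show "\<exists>g\<in>carrier ?E. g \<oplus>\<^bsub>?E\<^esub> f = \<zero>\<^bsub>?E\<^esub>"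
      by blast
  next
    fix f g assume f: "f \<in> carrier ?E" and g: "g \<in> carrier ?E"
    note fg = bimod_End_closed[OF f] bimod_End_closed[OF g] bimod_End_add[OF f] bimod_End_add[OF g]
      bimod_End_left[OF f] bimod_End_left[OF g] bimod_End_right[OF f] bimod_End_right[OF g]
    show "f \<oplus>\<^bsub>?E\<^esub> g \<in> carrier ?E"
      unfolding bimod_End_simps
      by (intro bimod_EndI) (auto simp: c fg l_distr r_distr a_ac)
    show "f \<oplus>\<^bsub>?E\<^esub> g = g \<oplus>\<^bsub>?E\<^esub> f"
      by (auto simp: fg a_ac intro!: restrict_ext)
    fix h assume h: "h \<in> carrier ?E"
    show "f \<oplus>\<^bsub>?E\<^esub> g \<oplus>\<^bsub>?E\<^esub> h = f \<oplus>\<^bsub>?E\<^esub> (g \<oplus>\<^bsub>?E\<^esub> h)"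
      by (auto simp: fg bimod_End_closed[OF h] a_ac intro!: restrict_ext)
  next
    show "\<zero>\<^bsub>?E\<^esub> \<in> carrier ?E"
      unfolding bimod_End_simps by (rule bimod_EndI) (auto simp: c)
  next
    fix f assume f: "f \<in> carrier ?E"
    show "\<zero>\<^bsub>?E\<^esub> \<oplus>\<^bsub>?E\<^esub> f = f"
      by (rule extensionalityI[OF _ bimod_End_extensional[OF f]]) (simp_all add: bimod_End_closed[OF f])
  qed
  show "monoid ?E"
  proof (rule monoidI)
    fix f g assume f: "f \<in> carrier ?E" and g: "g \<in> carrier ?E"
    note fg = bimod_End_closed[OF f] bimod_End_closed[OF g] bimod_End_add[OF f] bimod_End_add[OF g]
      bimod_End_left[OF f] bimod_End_left[OF g] bimod_End_right[OF f] bimod_End_right[OF g]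
    show "f \<otimes>\<^bsub>?E\<^esub> g \<in> carrier ?E"
      unfolding bimod_End_simps
      by (intro bimod_EndI) (auto simp: c compose_def fg)
    fix h assume h: "h \<in> carrier ?E"
    show "f \<otimes>\<^bsub>?E\<^esub> g \<otimes>\<^bsub>?E\<^esub> h = f \<otimes>\<^bsub>?E\<^esub> (g \<otimes>\<^bsub>?E\<^esub> h)"
      by (simp add: compose_def bimod_End_closed[OF h] cong: restrict_cong)
  next
    show "\<one>\<^bsub>?E\<^esub> \<in> carrier ?E"
      unfolding bimod_End_simps by (rule bimod_EndI) (auto simp: c)
  next
    fix f assume f: "f \<in> carrier ?E"
    show "\<one>\<^bsub>?E\<^esub> \<otimes>\<^bsub>?E\<^esub> f = f" "f \<otimes>\<^bsub>?E\<^esub> \<one>\<^bsub>?E\<^esub> = f"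
      by (rule extensionalityI[OF _ bimod_End_extensional[OF f]];
          simp add: compose_def bimod_End_closed[OF f])+
  qed
  fix f g h assume f: "f \<in> carrier ?E" and g: "g \<in> carrier ?E" and h: "h \<in> carrier ?E"
  note fg = bimod_End_closed[OF f] bimod_End_closed[OF g] bimod_End_closed[OF h] bimod_End_add[OF h]
  show "(f \<oplus>\<^bsub>?E\<^esub> g) \<otimes>\<^bsub>?E\<^esub> h = f \<otimes>\<^bsub>?E\<^esub> h \<oplus>\<^bsub>?E\<^esub> g \<otimes>\<^bsub>?E\<^esub> h"
    by (auto simp: fg compose_def intro!: restrict_ext)
  show "h \<otimes>\<^bsub>?E\<^esub> (f \<oplus>\<^bsub>?E\<^esub> g) = h \<otimes>\<^bsub>?E\<^esub> f \<oplus>\<^bsub>?E\<^esub> h \<otimes>\<^bsub>?E\<^esub> g"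
    by (auto simp: fg compose_def intro!: restrict_ext)
qed

lemma bimod_End_comm_group:
  assumes "\<rho> \<in> carrier K \<rightarrow> carrier R" "\<tau> \<in> carrier T \<rightarrow> carrier R"
  shows "comm_group (add_monoid (bimod_End R K \<rho> T \<tau>))"
  by (rule abelian_group.a_comm_group[OF ring.is_abelian_group[OF bimod_End_ring[OF assms]]])

text \<open>Evaluation at a is additive, so expansions in E and S can be checked pointwise.\<close>

lemma finsum_bimod_End:
  assumes "\<rho> \<in> carrier K \<rightarrow> carrier R" "\<tau> \<in> carrier T \<rightarrow> carrier R"
    and "F \<in> I \<rightarrow> carrier (bimod_End R K \<rho> T \<tau>)" "a \<in> carrier R"
  shows "finsum (bimod_End R K \<rho> T \<tau>) F I a = (\<Oplus>i\<in>I. F i a)"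
proof -
  let ?E = "bimod_End R K \<rho> T \<tau>"
  have "(\<lambda>f. f a) \<in> hom (add_monoid ?E) (add_monoid R)"
  proof (rule homI)
    fix f assume "f \<in> carrier (add_monoid ?E)"
    then have "f \<in> carrier ?E"
      by simp
    from bimod_End_closed[OF this assms(4)] show "f a \<in> carrier (add_monoid R)"
      by simp
  qed (simp add: assms(4))
  then show ?thesis
    unfolding finsum_def using assms(3)
    by (intro hom_finprod[where h = "\<lambda>f. f a"] bimod_End_comm_group[OF assms(1,2)] a_comm_group) auto
qed

lemma centralizer_subring:
  assumes "\<gamma> \<in> carrier C \<rightarrow> carrier R"
  shows "subring (carrier (centralizer_ring R C \<gamma>)) R"
proof (rule subringI)
  have c: "\<And>k. k \<in> carrier C \<Longrightarrow> \<gamma> k \<in> carrier R"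
    using assms by auto
  fix v w assume v: "v \<in> carrier (centralizer_ring R C \<gamma>)" and w: "w \<in> carrier (centralizer_ring R C \<gamma>)"
  show "\<ominus> v \<in> carrier (centralizer_ring R C \<gamma>)"
    using v by (auto simp: centralizer_ring_def c l_minus r_minus)
  show "v \<oplus> w \<in> carrier (centralizer_ring R C \<gamma>)"
    using v w by (auto simp: centralizer_ring_def c l_distr r_distr)
  show "v \<otimes> w \<in> carrier (centralizer_ring R C \<gamma>)"
    using v w by (auto simp: centralizer_ring_def c) (metis c m_assoc)
qed (use assms in \<open>auto simp: centralizer_ring_def Pi_iff\<close>)

lemma centralizer_ring_is_ring:
  assumes "\<gamma> \<in> carrier C \<rightarrow> carrier R"
  shows "ring (centralizer_ring R C \<gamma>)"
  using subring_is_ring[OF centralizer_subring[OF assms]] by (simp add: centralizer_ring_def)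

end

lemma opposite_ring_simps [simp]:
  "carrier (opposite_ring R) = carrier R"
  "x \<otimes>\<^bsub>opposite_ring R\<^esub> y = y \<otimes>\<^bsub>R\<^esub> x"
  "\<one>\<^bsub>opposite_ring R\<^esub> = \<one>\<^bsub>R\<^esub>"
  "x \<oplus>\<^bsub>opposite_ring R\<^esub> y = x \<oplus>\<^bsub>R\<^esub> y"
  "\<zero>\<^bsub>opposite_ring R\<^esub> = \<zero>\<^bsub>R\<^esub>"
  by (simp_all add: opposite_ring_def)

lemma (in ring) opposite_ring: "ring (opposite_ring R)"
proof (rule ringI)
  show "abelian_group (opposite_ring R)"
    by (rule abelian_groupI) (auto simp: a_ac intro: l_neg bexI[of _ "\<ominus> _"])
  show "monoid (opposite_ring R)"
    by (rule monoidI) (auto simp: m_assoc)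
qed (auto simp: l_distr r_distr)

lemma centralizer_ring_simps [simp]:
  "x \<otimes>\<^bsub>centralizer_ring A C \<gamma>\<^esub> y = x \<otimes>\<^bsub>A\<^esub> y"
  "\<one>\<^bsub>centralizer_ring A C \<gamma>\<^esub> = \<one>\<^bsub>A\<^esub>"
  "x \<oplus>\<^bsub>centralizer_ring A C \<gamma>\<^esub> y = x \<oplus>\<^bsub>A\<^esub> y"
  "\<zero>\<^bsub>centralizer_ring A C \<gamma>\<^esub> = \<zero>\<^bsub>A\<^esub>"
  by (simp_all add: centralizer_ring_def)

lemma centralizer_ring_iff:
  "v \<in> carrier (centralizer_ring A C \<gamma>)
    \<longleftrightarrow> v \<in> carrier A \<and> (\<forall>c\<in>carrier C. \<gamma> c \<otimes>\<^bsub>A\<^esub> v = v \<otimes>\<^bsub>A\<^esub> \<gamma> c)"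
  by (simp add: centralizer_ring_def)

section \<open>Subgroups and homomorphisms of commutative groups\<close>

lemma comm_group_subgroup:
  assumes "comm_group G" "subgroup H G"
  shows "comm_group (G\<lparr>carrier := H\<rparr>)"
proof -
  interpret comm_group G by fact
  interpret H: subgroup H G by fact
  show ?thesis
    by (rule group.group_comm_groupI[OF H.subgroup_is_group[OF is_group]]) (simp add: m_comm)
qed

text \<open>The inclusion is a homomorphism. This transfers an expansion in A \<otimes>_B A to one
  inside P.\<close>

lemma finprod_subgroup:
  assumes "comm_group G" "subgroup H G" "f \<in> I \<rightarrow> H"
  shows "finprod (G\<lparr>carrier := H\<rparr>) f I = finprod G f I"
  using hom_finprod[OF comm_group_subgroup[OF assms(1,2)] assms(1), of "\<lambda>x. x" f I]
    assms(3) subgroup.subset[OF assms(2)] by (auto simp: hom_def)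

lemma hom_comp: "\<lbrakk>f \<in> hom G H; g \<in> hom H K\<rbrakk> \<Longrightarrow> (\<lambda>x. g (f x)) \<in> hom G K"
  using hom_compose[of f G H g K] by (simp add: comp_def)

lemma hom_pointwise_mult:
  assumes "comm_group H" "f \<in> hom G H" "g \<in> hom G H"
  shows "(\<lambda>x. f x \<otimes>\<^bsub>H\<^esub> g x) \<in> hom G H"
proof -
  interpret comm_group H by fact
  show ?thesis
    using assms(2,3) by (auto simp: hom_def m_ac Pi_iff)
qed

section \<open>The tensor square of a ring extension\<close>

text \<open>Instantiated for A over B, where depth three lives, and for A over C, where depth two
  lives.\<close>

locale ring_ext = A: ring A + R: ring R
  for A :: "('a, 'k) ring_scheme" (structure) and R :: "('r, 'l) ring_scheme" and \<rho> :: "'r \<Rightarrow> 'a" +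
  assumes ext_hom: "\<rho> \<in> ring_hom R A"
begin

abbreviation "T \<equiv> ext_tensor A R \<rho>"
abbreviation "pure \<equiv> ext_pure A R \<rho>"
abbreviation "lact \<equiv> ext_tensor_left A R \<rho>"
abbreviation "ract \<equiv> ext_tensor_right A R \<rho>"

lemma ext_closed [simp, intro]: "r \<in> carrier R \<Longrightarrow> \<rho> r \<in> carrier A"
  by (rule ring_hom_closed[OF ext_hom])

sublocale tens: tensor R "add_monoid A" "\<lambda>a r. a \<otimes> \<rho> r" "add_monoid A" "\<lambda>r a. \<rho> r \<otimes> a"
  by (intro tensor.intro tensor_axioms.intro A.a_comm_group) auto

lemma tensor_comm_group: "comm_group T"
  unfolding ext_tensor_def by (rule tens.T.comm_group_axioms)

sublocale T: comm_group T
  by (rule tensor_comm_group)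

lemma pure_closed [simp, intro]: "\<lbrakk>x \<in> carrier A; y \<in> carrier A\<rbrakk> \<Longrightarrow> pure x y \<in> carrier T"
  using tens.pure_closed unfolding ext_tensor_def ext_pure_def by simp

lemma pure_add_left:
  "\<lbrakk>x \<in> carrier A; x' \<in> carrier A; y \<in> carrier A\<rbrakk> \<Longrightarrow> pure (x \<oplus> x') y = pure x y \<otimes>\<^bsub>T\<^esub> pure x' y"
  using tens.pure_add_left unfolding ext_tensor_def ext_pure_def by simp

lemma pure_add_right:
  "\<lbrakk>x \<in> carrier A; y \<in> carrier A; y' \<in> carrier A\<rbrakk> \<Longrightarrow> pure x (y \<oplus> y') = pure x y \<otimes>\<^bsub>T\<^esub> pure x y'"
  using tens.pure_add_right unfolding ext_tensor_def ext_pure_def by simp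

lemma pure_balanced:
  "\<lbrakk>x \<in> carrier A; r \<in> carrier R; y \<in> carrier A\<rbrakk> \<Longrightarrow> pure (x \<otimes> \<rho> r) y = pure x (\<rho> r \<otimes> y)"
  using tens.pure_balanced unfolding ext_pure_def by simp

lemma tensor_hom_eqI:
  assumes "group G" "f \<in> hom T G" "g \<in> hom T G"
    and "\<And>x y. \<lbrakk>x \<in> carrier A; y \<in> carrier A\<rbrakk> \<Longrightarrow> f (pure x y) = g (pure x y)"
    and "q \<in> carrier T"
  shows "f q = g q"
  using tens.hom_eqI[OF assms(1)] assms(2-) unfolding ext_tensor_def ext_pure_def by simp

lemma
  assumes "comm_group G"
    and "\<And>x y. \<lbrakk>x \<in> carrier A; y \<in> carrier A\<rbrakk> \<Longrightarrow> h x y \<in> carrier G"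
    and "\<And>x x' y. \<lbrakk>x \<in> carrier A; x' \<in> carrier A; y \<in> carrier A\<rbrakk> \<Longrightarrow> h (x \<oplus> x') y = h x y \<otimes>\<^bsub>G\<^esub> h x' y"
    and "\<And>x y y'. \<lbrakk>x \<in> carrier A; y \<in> carrier A; y' \<in> carrier A\<rbrakk> \<Longrightarrow> h x (y \<oplus> y') = h x y \<otimes>\<^bsub>G\<^esub> h x y'"
    and "\<And>x r y. \<lbrakk>x \<in> carrier A; r \<in> carrier R; y \<in> carrier A\<rbrakk> \<Longrightarrow> h (x \<otimes> \<rho> r) y = h x (\<rho> r \<otimes> y)"
  shows lift_hom: "tensor_lift G h \<in> hom T G"
    and lift_pure: "\<And>x y. \<lbrakk>x \<in> carrier A; y \<in> carrier A\<rbrakk> \<Longrightarrow> tensor_lift G h (pure x y) = h x y"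
proof -
  have "balanced R (add_monoid A) (\<lambda>a r. a \<otimes> \<rho> r) (add_monoid A) (\<lambda>r a. \<rho> r \<otimes> a) G h"
    unfolding balanced_def using assms(2-) by (auto intro!: homI)
  then show "tensor_lift G h \<in> hom T G"
    "\<And>x y. \<lbrakk>x \<in> carrier A; y \<in> carrier A\<rbrakk> \<Longrightarrow> tensor_lift G h (pure x y) = h x y"
    using tens.tensor_lift_hom[OF assms(1)] tens.tensor_lift_pure[OF assms(1)]
    unfolding ext_tensor_def ext_pure_def by simp_all
qed

text \<open>Multiplying the outer ends commutes with moving \<open>\<rho> r\<close> between the
  inner ones, so both maps respect the balancing.\<close>

lemma
  assumes a: "a \<in> carrier A"
  shows lact_hom: "lact a \<in> hom T T"
    and lact_pure [simp]: "\<And>x y. \<lbrakk>x \<in> carrier A; y \<in> carrier A\<rbrakk> \<Longrightarrow> lact a (pure x y) = pure (a \<otimes> x) y"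
    and ract_hom: "(\<lambda>q. ract q a) \<in> hom T T"
    and ract_pure [simp]: "\<And>x y. \<lbrakk>x \<in> carrier A; y \<in> carrier A\<rbrakk> \<Longrightarrow> ract (pure x y) a = pure x (y \<otimes> a)"
  unfolding ext_tensor_left_def ext_tensor_right_def using a
  by (intro lift_hom lift_pure tensor_comm_group;
      auto simp: A.r_distr A.l_distr pure_add_left pure_add_right pure_balanced A.m_assoc[symmetric];
      simp add: pure_balanced A.m_assoc)+

lemma lact_closed [simp, intro]: "\<lbrakk>a \<in> carrier A; q \<in> carrier T\<rbrakk> \<Longrightarrow> lact a q \<in> carrier T"
  by (rule hom_in_carrier[OF lact_hom])

lemma ract_closed [simp, intro]: "\<lbrakk>a \<in> carrier A; q \<in> carrier T\<rbrakk> \<Longrightarrow> ract q a \<in> carrier T"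
  by (rule hom_in_carrier[OF ract_hom])

section \<open>The A-A-bimodule structure of the tensor square\<close>

lemma lact_mult:
  assumes "a \<in> carrier A" "b \<in> carrier A" "q \<in> carrier T"
  shows "lact (a \<otimes> b) q = lact a (lact b q)"
  by (rule tensor_hom_eqI[OF T.is_group _ _ _ assms(3)])
    (use assms in \<open>auto intro!: lact_hom hom_comp[OF lact_hom lact_hom] simp: A.m_assoc\<close>)

lemma lact_ract:
  assumes "a \<in> carrier A" "b \<in> carrier A" "q \<in> carrier T"
  shows "lact a (ract q b) = ract (lact a q) b"
  by (rule tensor_hom_eqI[OF T.is_group _ _ _ assms(3)])
    (use assms in \<open>auto intro!: hom_comp[OF ract_hom lact_hom] hom_comp[OF lact_hom ract_hom]\<close>)

lemma lact_one:
  assumes "q \<in> carrier T"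
  shows "lact \<one> q = q"
  by (rule tensor_hom_eqI[OF T.is_group _ _ _ assms, of _ "\<lambda>q. q"])
    (auto intro!: lact_hom homI)

lemma lact_add:
  assumes "a \<in> carrier A" "b \<in> carrier A" "q \<in> carrier T"
  shows "lact (a \<oplus> b) q = lact a q \<otimes>\<^bsub>T\<^esub> lact b q"
  by (rule tensor_hom_eqI[OF T.is_group _ _ _ assms(3)])
    (use assms in \<open>auto intro!: lact_hom hom_pointwise_mult[OF tensor_comm_group]
      simp: A.l_distr pure_add_left\<close>)



subsection \<open>Contractions\<close>

text \<open>Exactly the linearity that makes the map sending x, y to
  \<open>\<beta> x \<otimes> y\<close> balanced over R; \<open>left_linear\<close> plays the same
  part for \<open>x \<otimes> \<alpha> y\<close>.\<close>

definition right_linear :: "('a \<Rightarrow> 'a) \<Rightarrow> bool" where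
  "right_linear \<beta> \<longleftrightarrow> \<beta> \<in> hom (add_monoid A) (add_monoid A)
    \<and> (\<forall>r\<in>carrier R. \<forall>a\<in>carrier A. \<beta> (a \<otimes> \<rho> r) = \<beta> a \<otimes> \<rho> r)"

definition left_linear :: "('a \<Rightarrow> 'a) \<Rightarrow> bool" where
  "left_linear \<alpha> \<longleftrightarrow> \<alpha> \<in> hom (add_monoid A) (add_monoid A)
    \<and> (\<forall>r\<in>carrier R. \<forall>a\<in>carrier A. \<alpha> (\<rho> r \<otimes> a) = \<rho> r \<otimes> \<alpha> a)"

text \<open>In Sweedler notation \<beta>(q^1) q^2. With \<beta> = \<alpha>(a -) it is the value at a
  of a left factor of the coproduct; with \<beta> in S and a centralizing tensor it is a
  change-of-quasibases coefficient.\<close>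

definition contract_left :: "('a \<Rightarrow> 'a) \<Rightarrow> ('a \<times> 'a \<Rightarrow>\<^sub>0 int) set \<Rightarrow> 'a" where
  "contract_left \<beta> = tensor_lift (add_monoid A) (\<lambda>x y. \<beta> x \<otimes> y)"

text \<open>In Sweedler notation q^1 \<alpha>(q^2). As a function of \<alpha> in E, with q = u_i, it
  is a coordinate functional of E over V.\<close>

definition contract_right :: "('a \<Rightarrow> 'a) \<Rightarrow> ('a \<times> 'a \<Rightarrow>\<^sub>0 int) set \<Rightarrow> 'a" where
  "contract_right \<alpha> = tensor_lift (add_monoid A) (\<lambda>x y. x \<otimes> \<alpha> y)"

lemma right_linearD:
  assumes "right_linear \<beta>"
  shows "\<And>a. a \<in> carrier A \<Longrightarrow> \<beta> a \<in> carrier A"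
    and "\<And>a b. \<lbrakk>a \<in> carrier A; b \<in> carrier A\<rbrakk> \<Longrightarrow> \<beta> (a \<oplus> b) = \<beta> a \<oplus> \<beta> b"
    and "\<And>a r. \<lbrakk>a \<in> carrier A; r \<in> carrier R\<rbrakk> \<Longrightarrow> \<beta> (a \<otimes> \<rho> r) = \<beta> a \<otimes> \<rho> r"
  using assms by (auto simp: right_linear_def hom_def)

lemma left_linearD:
  assumes "left_linear \<alpha>"
  shows "\<And>a. a \<in> carrier A \<Longrightarrow> \<alpha> a \<in> carrier A"
    and "\<And>a b. \<lbrakk>a \<in> carrier A; b \<in> carrier A\<rbrakk> \<Longrightarrow> \<alpha> (a \<oplus> b) = \<alpha> a \<oplus> \<alpha> b"
    and "\<And>a r. \<lbrakk>a \<in> carrier A; r \<in> carrier R\<rbrakk> \<Longrightarrow> \<alpha> (\<rho> r \<otimes> a) = \<rho> r \<otimes> \<alpha> a"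
  using assms by (auto simp: left_linear_def hom_def)

lemma
  assumes "right_linear \<beta>"
  shows contract_left_hom: "contract_left \<beta> \<in> hom T (add_monoid A)"
    and contract_left_pure:
      "\<And>x y. \<lbrakk>x \<in> carrier A; y \<in> carrier A\<rbrakk> \<Longrightarrow> contract_left \<beta> (pure x y) = \<beta> x \<otimes> y"
  unfolding contract_left_def using right_linearD[OF assms]
  by (intro lift_hom lift_pure A.a_comm_group; simp add: A.r_distr A.l_distr A.m_assoc)+

lemma
  assumes "left_linear \<alpha>"
  shows contract_right_hom: "contract_right \<alpha> \<in> hom T (add_monoid A)"
    and contract_right_pure:
      "\<And>x y. \<lbrakk>x \<in> carrier A; y \<in> carrier A\<rbrakk> \<Longrightarrow> contract_right \<alpha> (pure x y) = x \<otimes> \<alpha> y"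
  unfolding contract_right_def using left_linearD[OF assms]
  by (intro lift_hom lift_pure A.a_comm_group; simp add: A.r_distr A.l_distr A.m_assoc)+

lemma contract_left_closed:
  "\<lbrakk>right_linear \<beta>; q \<in> carrier T\<rbrakk> \<Longrightarrow> contract_left \<beta> q \<in> carrier A"
  using hom_in_carrier[OF contract_left_hom] by simp

lemma contract_right_closed:
  "\<lbrakk>left_linear \<alpha>; q \<in> carrier T\<rbrakk> \<Longrightarrow> contract_right \<alpha> q \<in> carrier A"
  using hom_in_carrier[OF contract_right_hom] by simp

lemma mult_left_hom: "a \<in> carrier A \<Longrightarrow> (\<lambda>x. a \<otimes> x) \<in> hom (add_monoid A) (add_monoid A)"
  by (auto intro!: homI simp: A.r_distr)

lemma mult_right_hom: "a \<in> carrier A \<Longrightarrow> (\<lambda>x. x \<otimes> a) \<in> hom (add_monoid A) (add_monoid A)"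
  by (auto intro!: homI simp: A.l_distr)

lemma add_pointwise_hom:
  "\<lbrakk>f \<in> hom G (add_monoid A); g \<in> hom G (add_monoid A)\<rbrakk> \<Longrightarrow> (\<lambda>x. f x \<oplus> g x) \<in> hom G (add_monoid A)"
  using hom_pointwise_mult[OF A.a_comm_group] by simp

lemma contract_left_ract:
  assumes "right_linear \<beta>" "q \<in> carrier T" "a \<in> carrier A"
  shows "contract_left \<beta> (ract q a) = contract_left \<beta> q \<otimes> a"
  by (rule tensor_hom_eqI[OF A.a_group _ _ _ assms(2)])
    (use assms right_linearD[OF assms(1)] in \<open>auto simp: contract_left_pure A.m_assoc
      intro!: hom_comp[OF ract_hom] hom_comp[OF _ mult_right_hom] contract_left_hom\<close>)

lemma contract_right_lact:
  assumes "left_linear \<alpha>" "q \<in> carrier T" "a \<in> carrier A"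
  shows "contract_right \<alpha> (lact a q) = a \<otimes> contract_right \<alpha> q"
  by (rule tensor_hom_eqI[OF A.a_group _ _ _ assms(2)])
    (use assms left_linearD[OF assms(1)] in \<open>auto simp: contract_right_pure A.m_assoc
      intro!: hom_comp[OF lact_hom] hom_comp[OF _ mult_left_hom] contract_right_hom\<close>)

text \<open>The factor a is absorbed into the argument of the map. As in the companions below, the
  second map is a parameter that has to agree only on the carrier, so that both plain lambda terms
  and the extensional elements of the endomorphism rings fit.\<close>

lemma contract_left_lact:
  assumes "right_linear \<beta>" "right_linear \<beta>'" "a \<in> carrier A" "q \<in> carrier T"
    and "\<And>x. x \<in> carrier A \<Longrightarrow> \<beta> (a \<otimes> x) = \<beta>' x"
  shows "contract_left \<beta> (lact a q) = contract_left \<beta>' q"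
  by (rule tensor_hom_eqI[OF A.a_group _ _ _ assms(4)])
    (use assms in \<open>auto simp: contract_left_pure intro!: hom_comp[OF lact_hom] contract_left_hom\<close>)

lemma contract_right_ract:
  assumes "left_linear \<alpha>" "left_linear \<alpha>'" "a \<in> carrier A" "q \<in> carrier T"
    and "\<And>x. x \<in> carrier A \<Longrightarrow> \<alpha> (x \<otimes> a) = \<alpha>' x"
  shows "contract_right \<alpha> (ract q a) = contract_right \<alpha>' q"
  by (rule tensor_hom_eqI[OF A.a_group _ _ _ assms(4)])
    (use assms in \<open>auto simp: contract_right_pure intro!: hom_comp[OF ract_hom] contract_right_hom\<close>)

lemma contract_left_add:
  assumes "right_linear \<beta>" "right_linear \<beta>'" "right_linear \<beta>''" "q \<in> carrier T"
    and "\<And>x. x \<in> carrier A \<Longrightarrow> \<beta>'' x = \<beta> x \<oplus> \<beta>' x"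
  shows "contract_left \<beta>'' q = contract_left \<beta> q \<oplus> contract_left \<beta>' q"
  by (rule tensor_hom_eqI[OF A.a_group _ _ _ assms(4)])
    (use assms right_linearD(1)[OF assms(1)] right_linearD(1)[OF assms(2)] in
      \<open>auto simp: contract_left_pure A.l_distr intro!: add_pointwise_hom contract_left_hom\<close>)

lemma contract_right_add:
  assumes "left_linear \<alpha>" "left_linear \<alpha>'" "left_linear \<alpha>''" "q \<in> carrier T"
    and "\<And>x. x \<in> carrier A \<Longrightarrow> \<alpha>'' x = \<alpha> x \<oplus> \<alpha>' x"
  shows "contract_right \<alpha>'' q = contract_right \<alpha> q \<oplus> contract_right \<alpha>' q"
  by (rule tensor_hom_eqI[OF A.a_group _ _ _ assms(4)])
    (use assms left_linearD(1)[OF assms(1)] left_linearD(1)[OF assms(2)] in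
      \<open>auto simp: contract_right_pure A.r_distr intro!: add_pointwise_hom contract_right_hom\<close>)

lemma contract_left_scale:
  assumes "right_linear \<beta>" "right_linear \<beta>'" "a \<in> carrier A" "q \<in> carrier T"
    and "\<And>x. x \<in> carrier A \<Longrightarrow> \<beta>' x = a \<otimes> \<beta> x"
  shows "contract_left \<beta>' q = a \<otimes> contract_left \<beta> q"
  by (rule tensor_hom_eqI[OF A.a_group _ _ _ assms(4)])
    (use assms right_linearD(1)[OF assms(1)] in \<open>auto simp: contract_left_pure A.m_assoc
      intro!: hom_comp[OF _ mult_left_hom] contract_left_hom\<close>)

lemma contract_right_scale:
  assumes "left_linear \<alpha>" "left_linear \<alpha>'" "a \<in> carrier A" "q \<in> carrier T"
    and "\<And>x. x \<in> carrier A \<Longrightarrow> \<alpha>' x = \<alpha> x \<otimes> a"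
  shows "contract_right \<alpha>' q = contract_right \<alpha> q \<otimes> a"
  by (rule tensor_hom_eqI[OF A.a_group _ _ _ assms(4)])
    (use assms left_linearD(1)[OF assms(1)] in \<open>auto simp: contract_right_pure A.m_assoc
      intro!: hom_comp[OF _ mult_right_hom] contract_right_hom\<close>)

end

section \<open>Depth three: the projective modules\<close>

lemma End_right_apply [simp]: "a \<in> carrier A \<Longrightarrow> End_right A f v a = f a \<otimes>\<^bsub>A\<^esub> v"
  by (simp add: End_right_def)

lemma End_left_apply [simp]: "a \<in> carrier A \<Longrightarrow> End_left A v f a = v \<otimes>\<^bsub>A\<^esub> f a"
  by (simp add: End_left_def)

text \<open>The scalar v stands to the right of f a, so right linearity over C forces it to move
  past \<open>\<gamma> k\<close>; this is where v being in the centralizer enters.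
  \<open>End_left_closed\<close> uses it on the other side.\<close>

lemma (in ring) End_right_closed:
  assumes "\<rho> \<in> carrier K \<rightarrow> carrier R" "\<gamma> \<in> carrier C \<rightarrow> carrier R"
    and f: "f \<in> carrier (bimod_End R K \<rho> C \<gamma>)" and v: "v \<in> carrier (centralizer_ring R C \<gamma>)"
  shows "End_right R f v \<in> carrier (bimod_End R K \<rho> C \<gamma>)"
proof (rule bimod_EndI)
  have c: "\<And>k. k \<in> carrier K \<Longrightarrow> \<rho> k \<in> carrier R" "\<And>k. k \<in> carrier C \<Longrightarrow> \<gamma> k \<in> carrier R" "v \<in> carrier R"
    using assms by (auto simp: centralizer_ring_iff)
  note f' = bimod_End_closed[OF f] bimod_End_add[OF f] bimod_End_left[OF f] bimod_End_right[OF f]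
  show "End_right R f v (a \<otimes> \<gamma> k) = End_right R f v a \<otimes> \<gamma> k" if "k \<in> carrier C" "a \<in> carrier R" for k a
    using that v by (simp add: f' c m_assoc centralizer_ring_iff)
qed (use assms in \<open>auto simp: End_right_def bimod_End_closed[OF f] bimod_End_add[OF f]
  bimod_End_left[OF f] centralizer_ring_iff l_distr m_assoc Pi_iff\<close>)

lemma (in ring) End_left_closed:
  assumes "\<gamma> \<in> carrier C \<rightarrow> carrier R" "\<tau> \<in> carrier K \<rightarrow> carrier R"
    and f: "f \<in> carrier (bimod_End R C \<gamma> K \<tau>)" and v: "v \<in> carrier (centralizer_ring R C \<gamma>)"
  shows "End_left R v f \<in> carrier (bimod_End R C \<gamma> K \<tau>)"
proof (rule bimod_EndI)
  have c: "\<And>k. k \<in> carrier K \<Longrightarrow> \<tau> k \<in> carrier R" "\<And>k. k \<in> carrier C \<Longrightarrow> \<gamma> k \<in> carrier R" "v \<in> carrier R"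
    using assms by (auto simp: centralizer_ring_iff)
  note f' = bimod_End_closed[OF f] bimod_End_add[OF f] bimod_End_left[OF f] bimod_End_right[OF f]
  show "End_left R v f (\<gamma> k \<otimes> a) = \<gamma> k \<otimes> End_left R v f a" if "k \<in> carrier C" "a \<in> carrier R" for k a
    using that v by (simp add: f' c m_assoc[symmetric] centralizer_ring_iff)
qed (use assms in \<open>auto simp: End_left_def bimod_End_closed[OF f] bimod_End_add[OF f]
  bimod_End_right[OF f] centralizer_ring_iff r_distr m_assoc Pi_iff\<close>)

context ring_ext
begin

section \<open>The subgroup of centralizing tensors\<close>

lemma ext_tensor_centralizer_iff:
  "p \<in> carrier (ext_tensor_centralizer A R \<rho> C \<gamma>)
    \<longleftrightarrow> p \<in> carrier T \<and> (\<forall>c\<in>carrier C. lact (\<gamma> c) p = ract p (\<gamma> c))"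
  by (simp add: ext_tensor_centralizer_def)

lemma centralizer_carrier_update:
  "ext_tensor_centralizer A R \<rho> C \<gamma> = T\<lparr>carrier := carrier (ext_tensor_centralizer A R \<rho> C \<gamma>)\<rparr>"
  by (simp add: ext_tensor_centralizer_def)

lemma centralizer_mult [simp]: "p \<otimes>\<^bsub>ext_tensor_centralizer A R \<rho> C \<gamma>\<^esub> q = p \<otimes>\<^bsub>T\<^esub> q"
  by (simp add: ext_tensor_centralizer_def)

text \<open>For each c the condition describes the equalizer of two endomorphisms of the tensor
  square.\<close>

lemma centralizer_subgroup:
  assumes "\<gamma> \<in> carrier C \<rightarrow> carrier A"
  shows "subgroup (carrier (ext_tensor_centralizer A R \<rho> C \<gamma>)) T" (is "subgroup ?P T")
proof (rule T.subgroupI)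
  have l: "group_hom T T (lact (\<gamma> c))" and r: "group_hom T T (\<lambda>q. ract q (\<gamma> c))" if "c \<in> carrier C" for c
    using assms that lact_hom[of "\<gamma> c"] ract_hom[of "\<gamma> c"] by (auto intro!: group_hom.intro group_hom_axioms.intro)
  show "?P \<subseteq> carrier T"
    by (auto simp: ext_tensor_centralizer_iff)
  have "\<one>\<^bsub>T\<^esub> \<in> ?P"
    using group_hom.hom_one[OF l] group_hom.hom_one[OF r] by (simp add: ext_tensor_centralizer_iff)
  then show "?P \<noteq> {}"
    by blast
  show "inv\<^bsub>T\<^esub> p \<in> ?P" if "p \<in> ?P" for p
    using that group_hom.hom_inv[OF l, of _ p] group_hom.hom_inv[OF r, of _ p]
    by (simp add: ext_tensor_centralizer_iff)
  show "p \<otimes>\<^bsub>T\<^esub> q \<in> ?P" if "p \<in> ?P" "q \<in> ?P" for p q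
    using that group_hom.hom_mult[OF l, of _ p q] group_hom.hom_mult[OF r, of _ p q]
    by (simp add: ext_tensor_centralizer_iff)
qed

lemma centralizer_comm_group:
  assumes "\<gamma> \<in> carrier C \<rightarrow> carrier A"
  shows "comm_group (ext_tensor_centralizer A R \<rho> C \<gamma>)"
  by (subst centralizer_carrier_update)
    (rule comm_group_subgroup[OF tensor_comm_group centralizer_subgroup[OF assms]])

text \<open>The operator \<open>Inl a\<close> sends 1 to a, so coefficients act from the left.
  \<open>Inl (\<rho> (\<phi> c))\<close> and \<open>Inr c\<close> have the same value at 1, hence
  agree on \<open>u i\<close>, which is the centralizing condition.\<close>

lemma right_depth_three_dual_basis:
  assumes \<phi>: "\<phi> \<in> carrier C \<rightarrow> carrier R" and D3: "right_depth_three A R C \<phi> \<rho>"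
  obtains n :: nat and f u where "\<And>i. i < n \<Longrightarrow> f i \<in> hom T (add_monoid A)"
    "\<And>i a q. \<lbrakk>i < n; a \<in> carrier A; q \<in> carrier T\<rbrakk> \<Longrightarrow> f i (lact a q) = a \<otimes> f i q"
    "\<And>i c q. \<lbrakk>i < n; c \<in> carrier C; q \<in> carrier T\<rbrakk> \<Longrightarrow> f i (ract q (\<rho> (\<phi> c))) = f i q \<otimes> \<rho> (\<phi> c)"
    "\<And>i. i < n \<Longrightarrow> u i \<in> carrier (ext_tensor_centralizer A R \<rho> C (\<rho> \<circ> \<phi>))"
    "\<And>q. q \<in> carrier T \<Longrightarrow> q = finprod T (\<lambda>i. lact (f i q) (u i)) {..<n}"
proof -
  let ?\<Omega> = "carrier A <+> carrier C"
  let ?actM = "case_sum lact (\<lambda>c q. ract q (\<rho> (\<phi> c)))"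
  let ?act = "case_sum (\<lambda>a x. a \<otimes> x) (\<lambda>c x. x \<otimes> \<rho> (\<phi> c))"
  obtain n :: nat where n: "iso_direct_summand ?\<Omega> T ?actM
      (product_group {..<n} (\<lambda>_. add_monoid A)) (pointwise_act {..<n} ?act)"
    using D3 unfolding right_depth_three_def by blast
  have c: "\<rho> (\<phi> c) \<in> carrier A" if "c \<in> carrier C" for c
    using \<phi> that by auto
  have 1: "?actM w q \<in> carrier T" if "w \<in> ?\<Omega>" "q \<in> carrier T" for w q
    using that c by auto
  have 2: "?act w \<in> hom (add_monoid A) (add_monoid A)" if "w \<in> ?\<Omega>" for w
    using that c by (auto intro!: mult_left_hom mult_right_hom)
  show thesis
  proof (rule summand_of_power_dual_basis[OF tensor_comm_group A.ring_axioms n 1 2, of Inl])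
    fix f u
    assume f: "\<And>i. i < n \<Longrightarrow> f i \<in> hom T (add_monoid A)"
      and fa: "\<And>i w q. \<lbrakk>i < n; w \<in> ?\<Omega>; q \<in> carrier T\<rbrakk> \<Longrightarrow> f i (?actM w q) = ?act w (f i q)"
      and u: "\<And>i. i < n \<Longrightarrow> u i \<in> carrier T"
      and uc: "\<And>i w w'. \<lbrakk>i < n; w \<in> ?\<Omega>; w' \<in> ?\<Omega>; ?act w \<one> = ?act w' \<one>\<rbrakk>
        \<Longrightarrow> ?actM w (u i) = ?actM w' (u i)"
      and dual: "\<And>q. q \<in> carrier T \<Longrightarrow> q = finprod T (\<lambda>i. ?actM (Inl (f i q)) (u i)) {..<n}"
    show thesis
    proof (rule that[of n f u])
      show "f i (lact a q) = a \<otimes> f i q" if "i < n" "a \<in> carrier A" "q \<in> carrier T" for i a q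
        using fa[of i "Inl a" q] that by (simp add: InlI)
      show "f i (ract q (\<rho> (\<phi> c))) = f i q \<otimes> \<rho> (\<phi> c)" if "i < n" "c \<in> carrier C" "q \<in> carrier T" for i c q
        using fa[of i "Inr c" q] that by (simp add: InrI)
      show "u i \<in> carrier (ext_tensor_centralizer A R \<rho> C (\<rho> \<circ> \<phi>))" if "i < n" for i
        using u[OF that] uc[OF that, of "Inl (\<rho> (\<phi> c))" "Inr c" for c] c
        by (simp add: ext_tensor_centralizer_iff InlI InrI)
      show "q = finprod T (\<lambda>i. lact (f i q) (u i)) {..<n}" if "q \<in> carrier T" for q
        using dual[OF that] by simp
    qed (rule f)
  qed auto
qed

text \<open>The mirror image: here the right A-action is the one that reaches every a from 1, so
  coefficients act from the right, and the base ring R is itself the ring being centralized.\<close>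

lemma left_depth_two_dual_basis:
  assumes D2: "left_depth_two A R \<rho>"
  obtains n :: nat and f u where "\<And>i. i < n \<Longrightarrow> f i \<in> hom T (add_monoid A)"
    "\<And>i a q. \<lbrakk>i < n; a \<in> carrier A; q \<in> carrier T\<rbrakk> \<Longrightarrow> f i (ract q a) = f i q \<otimes> a"
    "\<And>i c q. \<lbrakk>i < n; c \<in> carrier R; q \<in> carrier T\<rbrakk> \<Longrightarrow> f i (lact (\<rho> c) q) = \<rho> c \<otimes> f i q"
    "\<And>i. i < n \<Longrightarrow> u i \<in> carrier (ext_tensor_centralizer A R \<rho> R \<rho>)"
    "\<And>q. q \<in> carrier T \<Longrightarrow> q = finprod T (\<lambda>i. ract (u i) (f i q)) {..<n}"
proof -
  let ?\<Omega> = "carrier R <+> carrier A"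
  let ?actM = "case_sum (\<lambda>c. lact (\<rho> c)) (\<lambda>a q. ract q a)"
  let ?act = "case_sum (\<lambda>c x. \<rho> c \<otimes> x) (\<lambda>a x. x \<otimes> a)"
  obtain n :: nat where n: "iso_direct_summand ?\<Omega> T ?actM
      (product_group {..<n} (\<lambda>_. add_monoid A)) (pointwise_act {..<n} ?act)"
    using D2 unfolding left_depth_two_def by blast
  have 1: "?actM w q \<in> carrier T" if "w \<in> ?\<Omega>" "q \<in> carrier T" for w q
    using that by auto
  have 2: "?act w \<in> hom (add_monoid A) (add_monoid A)" if "w \<in> ?\<Omega>" for w
    using that by (auto intro!: mult_left_hom mult_right_hom)
  show thesis
  proof (rule summand_of_power_dual_basis[OF tensor_comm_group A.ring_axioms n 1 2, of Inr])
    fix f u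
    assume f: "\<And>i. i < n \<Longrightarrow> f i \<in> hom T (add_monoid A)"
      and fa: "\<And>i w q. \<lbrakk>i < n; w \<in> ?\<Omega>; q \<in> carrier T\<rbrakk> \<Longrightarrow> f i (?actM w q) = ?act w (f i q)"
      and u: "\<And>i. i < n \<Longrightarrow> u i \<in> carrier T"
      and uc: "\<And>i w w'. \<lbrakk>i < n; w \<in> ?\<Omega>; w' \<in> ?\<Omega>; ?act w \<one> = ?act w' \<one>\<rbrakk>
        \<Longrightarrow> ?actM w (u i) = ?actM w' (u i)"
      and dual: "\<And>q. q \<in> carrier T \<Longrightarrow> q = finprod T (\<lambda>i. ?actM (Inr (f i q)) (u i)) {..<n}"
    show thesis
    proof (rule that[of n f u])
      show "f i (ract q a) = f i q \<otimes> a" if "i < n" "a \<in> carrier A" "q \<in> carrier T" for i a q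
        using fa[of i "Inr a" q] that by (simp add: InrI)
      show "f i (lact (\<rho> c) q) = \<rho> c \<otimes> f i q" if "i < n" "c \<in> carrier R" "q \<in> carrier T" for i c q
        using fa[of i "Inl c" q] that by (simp add: InlI)
      show "u i \<in> carrier (ext_tensor_centralizer A R \<rho> R \<rho>)" if "i < n" for i
        using u[OF that] uc[OF that, of "Inl c" "Inr (\<rho> c)" for c]
        by (simp add: ext_tensor_centralizer_iff InlI InrI)
      show "q = finprod T (\<lambda>i. ract (u i) (f i q)) {..<n}" if "q \<in> carrier T" for q
        using dual[OF that] by simp
    qed (rule f)
  qed auto
qed

text \<open>The content is closure: \<open>\<gamma> c\<close> first passes v, because v is in V, and
  then p, because p is in P.\<close>

lemma centralizer_left_module:
  assumes \<gamma>: "\<gamma> \<in> carrier C \<rightarrow> carrier A"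
  shows "left_module (centralizer_ring A C \<gamma>) (ext_tensor_centralizer A R \<rho> C \<gamma>) lact"
    (is "left_module ?V ?P _")
proof (intro left_module.intro left_module_axioms.intro)
  show "ring ?V"
    by (rule A.centralizer_ring_is_ring[OF \<gamma>])
  show "comm_group ?P"
    by (rule centralizer_comm_group[OF \<gamma>])
  have g: "\<gamma> c \<in> carrier A" if "c \<in> carrier C" for c
    using \<gamma> that by auto
  fix v p assume v: "v \<in> carrier ?V" and p: "p \<in> carrier ?P"
  have "lact (\<gamma> c) (lact v p) = ract (lact v p) (\<gamma> c)" if c: "c \<in> carrier C" for c
  proof -
    have "lact (\<gamma> c) (lact v p) = lact (\<gamma> c \<otimes> v) p"
      using v p g[OF c] by (simp add: lact_mult centralizer_ring_iff ext_tensor_centralizer_iff)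
    also have "\<gamma> c \<otimes> v = v \<otimes> \<gamma> c"
      using v c by (simp add: centralizer_ring_iff)
    also have "lact (v \<otimes> \<gamma> c) p = ract (lact v p) (\<gamma> c)"
      using v p c g[OF c]
      by (simp add: lact_mult lact_ract[symmetric] centralizer_ring_iff ext_tensor_centralizer_iff)
    finally show ?thesis .
  qed
  then show "lact v p \<in> carrier ?P"
    using v p by (simp add: centralizer_ring_iff ext_tensor_centralizer_iff)
qed (auto simp: centralizer_ring_iff ext_tensor_centralizer_iff lact_mult lact_add lact_one
  hom_mult[OF lact_hom])

lemma centralizer_fgp:
  assumes \<phi>: "\<phi> \<in> carrier C \<rightarrow> carrier R" and D3: "right_depth_three A R C \<phi> \<rho>"
  shows "fgp_left_module (centralizer_ring A C (\<rho> \<circ> \<phi>)) (ext_tensor_centralizer A R \<rho> C (\<rho> \<circ> \<phi>)) lact"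
    (is "fgp_left_module ?V ?P _")
proof -
  have \<gamma>: "\<rho> \<circ> \<phi> \<in> carrier C \<rightarrow> carrier A"
    using \<phi> by (auto simp: Pi_iff)
  have PT: "p \<in> carrier T" if "p \<in> carrier ?P" for p
    using that by (simp add: ext_tensor_centralizer_iff)
  interpret VM: left_module ?V ?P lact
    by (rule centralizer_left_module[OF \<gamma>])
  obtain n :: nat and f u where f: "\<And>i. i < n \<Longrightarrow> f i \<in> hom T (add_monoid A)"
      "\<And>i a q. \<lbrakk>i < n; a \<in> carrier A; q \<in> carrier T\<rbrakk> \<Longrightarrow> f i (lact a q) = a \<otimes> f i q"
      "\<And>i c q. \<lbrakk>i < n; c \<in> carrier C; q \<in> carrier T\<rbrakk> \<Longrightarrow> f i (ract q (\<rho> (\<phi> c))) = f i q \<otimes> \<rho> (\<phi> c)"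
    and u: "\<And>i. i < n \<Longrightarrow> u i \<in> carrier ?P"
    and dual: "\<And>q. q \<in> carrier T \<Longrightarrow> q = finprod T (\<lambda>i. lact (f i q) (u i)) {..<n}"
    by (rule right_depth_three_dual_basis[OF \<phi> D3]) blast
  \<comment> \<open>Since f_i respects both actions, c f_i(p) = f_i(c p) = f_i(p c) = f_i(p) c for p
    in P.\<close>
  have fV: "f i p \<in> carrier ?V" if i: "i < n" and p: "p \<in> carrier ?P" for i p
  proof -
    have "\<rho> (\<phi> c) \<otimes> f i p = f i p \<otimes> \<rho> (\<phi> c)" if c: "c \<in> carrier C" for c
      using f(2)[OF i _ PT[OF p], of "\<rho> (\<phi> c)"] f(3)[OF i c PT[OF p]] p c ext_closed[OF funcset_mem[OF \<phi> c]]
      by (auto simp: ext_tensor_centralizer_iff)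
    then show ?thesis
      using hom_in_carrier[OF f(1)[OF i] PT[OF p]] by (simp add: centralizer_ring_iff)
  qed
  show ?thesis
  proof (rule VM.dual_basis_imp_fgp[of "{..<n}" u f])
    fix i assume "i \<in> {..<n}"
    then show "f i \<in> hom ?P (add_monoid ?V)"
      using fV PT hom_mult[OF f(1)] by (auto intro!: homI)
  next
    fix p assume p: "p \<in> carrier ?P"
    have "p = finprod T (\<lambda>i. lact (f i p) (u i)) {..<n}"
      by (rule dual[OF PT[OF p]])
    \<comment> \<open>All terms lie in P by the module structure, so the expansion of p in the
      tensor square already takes place in P.\<close>
    also have "\<dots> = finprod ?P (\<lambda>i. lact (f i p) (u i)) {..<n}"
      by (subst centralizer_carrier_update, rule finprod_subgroup[OF tensor_comm_group
          centralizer_subgroup[OF \<gamma>], symmetric]) (auto intro!: VM.act_closed fV u p)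
    finally show "p = finprod ?P (\<lambda>i. lact (f i p) (u i)) {..<n}" .
  qed (use u f(2) PT in \<open>auto simp: centralizer_ring_iff\<close>)
qed

section \<open>Bimodule endomorphisms as a right module over the centralizer\<close>

lemma bimod_End_left_linear:
  "f \<in> carrier (bimod_End A R \<rho> C \<gamma>) \<Longrightarrow> left_linear f"
  by (auto simp: left_linear_def bimod_End_def)

lemma bimod_End_right_linear:
  "f \<in> carrier (bimod_End A C \<gamma> R \<rho>) \<Longrightarrow> right_linear f"
  by (auto simp: right_linear_def bimod_End_def)

lemma bimod_End_right_module:
  assumes \<gamma>: "\<gamma> \<in> carrier C \<rightarrow> carrier A"
  shows "left_module (opposite_ring (centralizer_ring A C \<gamma>)) (add_monoid (bimod_End A R \<rho> C \<gamma>))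
    (\<lambda>v f. End_right A f v)" (is "left_module ?V ?E ?act")
proof (intro left_module.intro left_module_axioms.intro)
  have \<rho>: "\<rho> \<in> carrier R \<rightarrow> carrier A"
    by auto
  show "ring ?V"
    by (rule ring.opposite_ring[OF A.centralizer_ring_is_ring[OF \<gamma>]])
  show "comm_group ?E"
    by (rule A.bimod_End_comm_group[OF \<rho> \<gamma>])
  fix f assume "f \<in> carrier ?E"
  then have f: "f \<in> carrier (bimod_End A R \<rho> C \<gamma>)"
    by simp
  show "End_right A f \<one>\<^bsub>?V\<^esub> = f"
    by (rule extensionalityI[OF _ bimod_End_extensional[OF f]])
      (simp_all add: End_right_def bimod_End_closed[OF f])
  fix v assume v: "v \<in> carrier ?V"
  show "End_right A f v \<in> carrier ?E"
    using A.End_right_closed[OF \<rho> \<gamma> f] v by simp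
  show "End_right A (f \<otimes>\<^bsub>?E\<^esub> g) v = End_right A f v \<otimes>\<^bsub>?E\<^esub> End_right A g v" if "g \<in> carrier ?E" for g
  proof -
    have g: "g \<in> carrier (bimod_End A R \<rho> C \<gamma>)"
      using that by simp
    show ?thesis
      using v by (auto simp: End_right_def bimod_End_closed[OF f] bimod_End_closed[OF g] A.l_distr
          centralizer_ring_iff intro!: restrict_ext)
  qed
  fix w assume w: "w \<in> carrier ?V"
  show "End_right A f (v \<oplus>\<^bsub>?V\<^esub> w) = End_right A f v \<otimes>\<^bsub>?E\<^esub> End_right A f w"
    using v w by (auto simp: End_right_def bimod_End_closed[OF f] A.r_distr
        centralizer_ring_iff intro!: restrict_ext)
  show "End_right A f (v \<otimes>\<^bsub>?V\<^esub> w) = End_right A (End_right A f w) v"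
    using v w by (auto simp: End_right_def bimod_End_closed[OF f] A.m_assoc
        centralizer_ring_iff intro!: restrict_ext)
qed

text \<open>
  Applying \<open>a \<otimes> b \<mapsto> a (\<alpha> b)\<close> to \<open>1 \<otimes> y = \<Sum>\<^sub>i f\<^sub>i(1 \<otimes> y) u\<^sub>i\<close> gives
  \<open>\<alpha>(y) = \<Sum>\<^sub>i f\<^sub>i(1 \<otimes> y) (u\<^sub>i\<^sup>1 \<alpha>(u\<^sub>i\<^sup>2))\<close>, a dual basis of \<open>E\<close> over \<open>V\<close>.
\<close>

lemma bimod_End_fgp:
  assumes \<phi>: "\<phi> \<in> carrier C \<rightarrow> carrier R" and D3: "right_depth_three A R C \<phi> \<rho>"
  shows "fgp_right_module (centralizer_ring A C (\<rho> \<circ> \<phi>)) (add_monoid (bimod_End A R \<rho> C (\<rho> \<circ> \<phi>)))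
    (End_right A)" (is "fgp_right_module ?V (add_monoid ?E) _")
proof -
  let ?P = "ext_tensor_centralizer A R \<rho> C (\<rho> \<circ> \<phi>)"
  have \<rho>: "\<rho> \<in> carrier R \<rightarrow> carrier A" and \<gamma>: "\<rho> \<circ> \<phi> \<in> carrier C \<rightarrow> carrier A"
    using \<phi> by (auto simp: Pi_iff)
  have \<gamma>c: "\<rho> (\<phi> c) \<in> carrier A" if "c \<in> carrier C" for c
    using \<phi> that by auto
  have PT: "p \<in> carrier T" if "p \<in> carrier ?P" for p
    using that by (simp add: ext_tensor_centralizer_iff)
  interpret VM: left_module "opposite_ring ?V" "add_monoid ?E" "\<lambda>v f. End_right A f v"
    by (rule bimod_End_right_module[OF \<gamma>])
  obtain n :: nat and f u where f: "\<And>i. i < n \<Longrightarrow> f i \<in> hom T (add_monoid A)"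
      "\<And>i a q. \<lbrakk>i < n; a \<in> carrier A; q \<in> carrier T\<rbrakk> \<Longrightarrow> f i (lact a q) = a \<otimes> f i q"
      "\<And>i c q. \<lbrakk>i < n; c \<in> carrier C; q \<in> carrier T\<rbrakk> \<Longrightarrow> f i (ract q (\<rho> (\<phi> c))) = f i q \<otimes> \<rho> (\<phi> c)"
    and u: "\<And>i. i < n \<Longrightarrow> u i \<in> carrier ?P"
    and dual: "\<And>q. q \<in> carrier T \<Longrightarrow> q = finprod T (\<lambda>i. lact (f i q) (u i)) {..<n}"
    by (rule right_depth_three_dual_basis[OF \<phi> D3]) blast
  have f_closed: "f i q \<in> carrier A" if "i < n" "q \<in> carrier T" for i q
    using hom_in_carrier[OF f(1)] that by auto
  \<comment> \<open>The coordinate map pulled back along y -> 1 \<otimes> y.\<close>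
  define e where "e i = (\<lambda>y\<in>carrier A. f i (pure \<one> y))" for i
  have e: "e i \<in> carrier ?E" if i: "i < n" for i
  proof (rule bimod_EndI)
    fix a b assume ab: "a \<in> carrier A" "b \<in> carrier A"
    show "e i a \<in> carrier A"
      using ab i by (simp add: e_def f_closed)
    show "e i (a \<oplus> b) = e i a \<oplus> e i b"
      using ab hom_mult[OF f(1)[OF i], of "pure \<one> a" "pure \<one> b"] by (simp add: e_def pure_add_right)
  next
    fix r a assume *: "r \<in> carrier R" "a \<in> carrier A"
    \<comment> \<open>An element of B crosses the tensor sign, so left linearity of f_i over A
      becomes left linearity of e_i over B.\<close>
    have "pure \<one> (\<rho> r \<otimes> a) = lact (\<rho> r) (pure \<one> a)"
      using * pure_balanced[of \<one> r a] by simp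
    then show "e i (\<rho> r \<otimes> a) = \<rho> r \<otimes> e i a"
      using * f(2)[OF i, of "\<rho> r" "pure \<one> a"] by (simp add: e_def)
  next
    fix c a assume *: "c \<in> carrier C" "a \<in> carrier A"
    then show "e i (a \<otimes> (\<rho> \<circ> \<phi>) c) = e i a \<otimes> (\<rho> \<circ> \<phi>) c"
      using f(3)[OF i *(1), of "pure \<one> a"] \<gamma>c by (simp add: e_def)
  qed (simp add: e_def)
  define v where "v i \<alpha> = contract_right \<alpha> (u i)" for i \<alpha>
  \<comment> \<open>With u = u_i: c u^1 \<alpha>(u^2) = u^1 \<alpha>(u^2 c) because u centralizes C,
    and this is u^1 \<alpha>(u^2) c because \<alpha> is right C-linear.\<close>
  have vV: "v i \<alpha> \<in> carrier ?V" if i: "i < n" and \<alpha>: "\<alpha> \<in> carrier ?E" for i \<alpha>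
  proof -
    note lin = bimod_End_left_linear[OF \<alpha>]
    have "\<rho> (\<phi> c) \<otimes> v i \<alpha> = v i \<alpha> \<otimes> \<rho> (\<phi> c)" if c: "c \<in> carrier C" for c
    proof -
      have lin': "left_linear (\<lambda>x. \<alpha> x \<otimes> \<rho> (\<phi> c))"
        using left_linearD[OF lin] c \<gamma>c by (auto simp: left_linear_def A.l_distr A.m_assoc intro!: homI)
      have "\<rho> (\<phi> c) \<otimes> v i \<alpha> = contract_right \<alpha> (lact (\<rho> (\<phi> c)) (u i))"
        unfolding v_def using c i u PT \<gamma>c by (simp add: contract_right_lact[OF lin])
      also have "lact (\<rho> (\<phi> c)) (u i) = ract (u i) (\<rho> (\<phi> c))"
        using u[OF i] c by (simp add: ext_tensor_centralizer_iff)
      also have "contract_right \<alpha> \<dots> = contract_right (\<lambda>x. \<alpha> x \<otimes> \<rho> (\<phi> c)) (u i)"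
        using bimod_End_right[OF \<alpha> c] c i u PT \<gamma>c by (intro contract_right_ract[OF lin lin']) auto
      also have "\<dots> = v i \<alpha> \<otimes> \<rho> (\<phi> c)"
        unfolding v_def using c i u PT \<gamma>c by (intro contract_right_scale[OF lin lin']) auto
      finally show ?thesis .
    qed
    then show ?thesis
      using contract_right_closed[OF lin PT[OF u[OF i]]] by (simp add: v_def centralizer_ring_iff)
  qed
  have "fgp_left_module (opposite_ring ?V) (add_monoid ?E) (\<lambda>v f. End_right A f v)"
  proof (rule VM.dual_basis_imp_fgp[of "{..<n}" e v])
    fix i assume "i \<in> {..<n}"
    then have i: "i < n"
      by simp
    show "v i \<in> hom (add_monoid ?E) (add_monoid (opposite_ring ?V))"
    proof (rule homI)
      fix \<alpha> \<beta> assume "\<alpha> \<in> carrier (add_monoid ?E)" "\<beta> \<in> carrier (add_monoid ?E)"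
      then have *: "\<alpha> \<in> carrier ?E" "\<beta> \<in> carrier ?E" "\<alpha> \<oplus>\<^bsub>?E\<^esub> \<beta> \<in> carrier ?E"
        using VM.M.m_closed[of \<alpha> \<beta>] by simp_all
      have "v i (\<alpha> \<oplus>\<^bsub>?E\<^esub> \<beta>) = v i \<alpha> \<oplus> v i \<beta>"
        unfolding v_def
        by (rule contract_right_add[OF *[THEN bimod_End_left_linear] PT[OF u[OF i]]]) simp
      then show "v i (\<alpha> \<otimes>\<^bsub>add_monoid ?E\<^esub> \<beta>) = v i \<alpha> \<otimes>\<^bsub>add_monoid (opposite_ring ?V)\<^esub> v i \<beta>"
        by simp
    qed (simp add: vV i)
    show "v i (End_right A \<alpha> w) = w \<otimes>\<^bsub>opposite_ring ?V\<^esub> v i \<alpha>"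
      if w: "w \<in> carrier (opposite_ring ?V)" and \<alpha>: "\<alpha> \<in> carrier (add_monoid ?E)" for w \<alpha>
    proof -
      have *: "\<alpha> \<in> carrier ?E" "End_right A \<alpha> w \<in> carrier ?E"
        using VM.act_closed[OF w \<alpha>] \<alpha> by simp_all
      have "v i (End_right A \<alpha> w) = v i \<alpha> \<otimes> w"
        unfolding v_def using w
        by (intro contract_right_scale[OF *[THEN bimod_End_left_linear] _ PT[OF u[OF i]]])
          (simp_all add: centralizer_ring_iff)
      then show ?thesis
        by simp
    qed
  next
    fix \<alpha> assume "\<alpha> \<in> carrier (add_monoid ?E)"
    then have \<alpha>: "\<alpha> \<in> carrier ?E"
      by simp
    note lin = bimod_End_left_linear[OF \<alpha>]
    have terms: "(\<lambda>i. End_right A (e i) (v i \<alpha>)) \<in> {..<n} \<rightarrow> carrier ?E"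
      using e vV \<alpha> A.End_right_closed[OF \<rho> \<gamma>] by blast
    have sum: "finsum ?E (\<lambda>i. End_right A (e i) (v i \<alpha>)) {..<n} \<in> carrier ?E"
      using VM.M.finprod_closed[of "\<lambda>i. End_right A (e i) (v i \<alpha>)"] terms by (simp add: finsum_def)
    have "\<alpha> = finsum ?E (\<lambda>i. End_right A (e i) (v i \<alpha>)) {..<n}"
    proof (rule bimod_End_eqI[OF \<alpha> sum])
      fix y assume y: "y \<in> carrier A"
      have "\<alpha> y = contract_right \<alpha> (pure \<one> y)"
        using y left_linearD(1)[OF lin] by (simp add: contract_right_pure[OF lin])
      also have "\<dots> = contract_right \<alpha> (finprod T (\<lambda>i. lact (f i (pure \<one> y)) (u i)) {..<n})"
        using dual[of "pure \<one> y"] y by simp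
      also have "\<dots> = (\<Oplus>i\<in>{..<n}. contract_right \<alpha> (lact (f i (pure \<one> y)) (u i)))"
        unfolding finsum_def using y u PT f_closed
        by (intro hom_finprod[OF tensor_comm_group A.a_comm_group contract_right_hom[OF lin]]) auto
      also have "\<dots> = (\<Oplus>i\<in>{..<n}. End_right A (e i) (v i \<alpha>) y)"
        using y u PT f_closed contract_right_closed[OF lin]
        by (intro A.add.finprod_cong') (auto simp: contract_right_lact[OF lin] e_def v_def)
      also have "\<dots> = finsum ?E (\<lambda>i. End_right A (e i) (v i \<alpha>)) {..<n} y"
        using A.finsum_bimod_End[OF \<rho> \<gamma> terms y] by simp
      finally show "\<alpha> y = finsum ?E (\<lambda>i. End_right A (e i) (v i \<alpha>)) {..<n} y" .
    qed
    then show "\<alpha> = finprod (add_monoid ?E) (\<lambda>i. End_right A (e i) (v i \<alpha>)) {..<n}"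
      by (simp add: finsum_def)
  qed (use e in auto)
  then show ?thesis
    by (simp add: fgp_right_module_def)
qed

end

section \<open>Depth two: the coproduct and the coideal property\<close>

context ring_ext
begin

text \<open>In this part R takes the role of the bottom ring C of the tower; the middle ring B
  enters only as a parameter of individual lemmas.\<close>

abbreviation "V \<equiv> centralizer_ring A R \<rho>"
abbreviation "S \<equiv> bimod_End A R \<rho> R \<rho>"
abbreviation "C2 \<equiv> ext_tensor_centralizer A R \<rho> R \<rho>"

section \<open>Contractions against centralizing tensors\<close>

lemma right_linear_translate:
  assumes "right_linear \<beta>" "a \<in> carrier A"
  shows "right_linear (\<lambda>x. \<beta> (a \<otimes> x))"
  using right_linearD[OF assms(1)] assms(2)
  by (auto simp: right_linear_def A.r_distr A.m_assoc[symmetric] intro!: homI)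

lemma right_linear_mult:
  assumes "right_linear \<beta>" "a \<in> carrier A"
  shows "right_linear (\<lambda>x. a \<otimes> \<beta> x)"
  using right_linearD[OF assms(1)] assms(2)
  by (auto simp: right_linear_def A.r_distr A.m_assoc intro!: homI)

lemma D2_contract_apply:
  "a \<in> carrier A \<Longrightarrow> D2_contract A \<alpha> q a = contract_left (\<lambda>x. \<alpha> (a \<otimes> x)) q"
  by (simp add: D2_contract_def contract_left_def)

text \<open>The ring acting on the left is arbitrary so that the lemma covers both S and E. Left
  linearity is inherited from \<alpha>, as b pulls out of \<alpha>(b a t^1) t^2. For right
  linearity, \<open>\<rho> r\<close> moves through t: \<alpha>(a r t^1) t^2 = \<alpha>(a t^1) t^2
  r.\<close>

lemma D2_contract_closed:
  assumes \<psi>: "\<psi> \<in> carrier B \<rightarrow> carrier A" and \<alpha>: "\<alpha> \<in> carrier (bimod_End A B \<psi> R \<rho>)"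
    and t: "t \<in> carrier C2"
  shows "D2_contract A \<alpha> t \<in> carrier (bimod_End A B \<psi> R \<rho>)"
proof (rule bimod_EndI)
  have \<psi>b: "\<psi> b \<in> carrier A" if "b \<in> carrier B" for b
    using \<psi> that by auto
  note lin = bimod_End_right_linear[OF \<alpha>]
  note tr = right_linear_translate[OF lin]
  have tT: "t \<in> carrier T"
    using t by (simp add: ext_tensor_centralizer_iff)
  fix a assume a: "a \<in> carrier A"
  show "D2_contract A \<alpha> t a \<in> carrier A"
    using contract_left_closed[OF tr[OF a] tT] a by (simp add: D2_contract_apply)
  show "D2_contract A \<alpha> t (a \<oplus> b) = D2_contract A \<alpha> t a \<oplus> D2_contract A \<alpha> t b"
    if b: "b \<in> carrier A" for b
  proof -
    have "contract_left (\<lambda>x. \<alpha> ((a \<oplus> b) \<otimes> x)) t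
        = contract_left (\<lambda>x. \<alpha> (a \<otimes> x)) t \<oplus> contract_left (\<lambda>x. \<alpha> (b \<otimes> x)) t"
      using a b by (intro contract_left_add tr tT) (auto simp: A.l_distr bimod_End_add[OF \<alpha>])
    then show ?thesis
      using a b by (simp add: D2_contract_apply)
  qed
  show "D2_contract A \<alpha> t (\<psi> b \<otimes> a) = \<psi> b \<otimes> D2_contract A \<alpha> t a" if b: "b \<in> carrier B" for b
  proof -
    have "contract_left (\<lambda>x. \<alpha> (\<psi> b \<otimes> a \<otimes> x)) t = \<psi> b \<otimes> contract_left (\<lambda>x. \<alpha> (a \<otimes> x)) t"
      using a b \<psi>b by (intro contract_left_scale tr tT) (auto simp: A.m_assoc bimod_End_left[OF \<alpha>])
    then show ?thesis
      using a b \<psi>b by (simp add: D2_contract_apply)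
  qed
  show "D2_contract A \<alpha> t (a \<otimes> \<rho> r) = D2_contract A \<alpha> t a \<otimes> \<rho> r" if r: "r \<in> carrier R" for r
  proof -
    have "contract_left (\<lambda>x. \<alpha> (a \<otimes> \<rho> r \<otimes> x)) t = contract_left (\<lambda>x. \<alpha> (a \<otimes> x)) (lact (\<rho> r) t)"
      using a r tT by (intro contract_left_lact[symmetric] tr) (auto simp: A.m_assoc)
    also have "lact (\<rho> r) t = ract t (\<rho> r)"
      using t r by (simp add: ext_tensor_centralizer_iff)
    also have "contract_left (\<lambda>x. \<alpha> (a \<otimes> x)) \<dots> = contract_left (\<lambda>x. \<alpha> (a \<otimes> x)) t \<otimes> \<rho> r"
      using a r tT by (intro contract_left_ract tr) auto
    finally show ?thesis
      using a r by (simp add: D2_contract_apply)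
  qed
qed (simp add: D2_contract_def)

text \<open>By left linearity c enters \<beta>, by centrality of t it reappears on the far right.
  This makes the coefficients between two systems of quasibases legitimate scalars for the tensor
  product over V.\<close>

lemma contract_left_centralizer:
  assumes \<beta>: "\<beta> \<in> carrier S" and t: "t \<in> carrier C2"
  shows "contract_left \<beta> t \<in> carrier V"
proof -
  note lin = bimod_End_right_linear[OF \<beta>]
  have tT: "t \<in> carrier T"
    using t by (simp add: ext_tensor_centralizer_iff)
  have "\<rho> c \<otimes> contract_left \<beta> t = contract_left \<beta> t \<otimes> \<rho> c" if c: "c \<in> carrier R" for c
  proof -
    have "\<rho> c \<otimes> contract_left \<beta> t = contract_left (\<lambda>x. \<rho> c \<otimes> \<beta> x) t"
      using c tT by (intro contract_left_scale[symmetric] right_linear_mult lin) auto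
    also have "\<dots> = contract_left \<beta> (lact (\<rho> c) t)"
      using c tT by (intro contract_left_lact[symmetric] right_linear_mult lin)
        (auto simp: bimod_End_left[OF \<beta>])
    also have "lact (\<rho> c) t = ract t (\<rho> c)"
      using t c by (simp add: ext_tensor_centralizer_iff)
    also have "contract_left \<beta> \<dots> = contract_left \<beta> t \<otimes> \<rho> c"
      using c tT by (intro contract_left_ract lin) auto
    finally show ?thesis .
  qed
  then show ?thesis
    using contract_left_closed[OF lin tT] by (simp add: centralizer_ring_iff)
qed

text \<open>The quasibases are t_i = u_i and \<beta>_i(x) = f_i(x \<otimes> 1). Right A-linearity
  gives f_i(x \<otimes> y) = \<beta>_i(x) y, so the dual basis identity at x \<otimes> y becomes the
  quasibase identity.\<close>

lemma quasibases_exist: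
  assumes "left_depth_two A R \<rho>"
  obtains n \<beta> t where "left_D2_quasibases A R \<rho> n \<beta> t"
proof -
  obtain n :: nat and f u where f: "\<And>i. i < n \<Longrightarrow> f i \<in> hom T (add_monoid A)"
      "\<And>i a q. \<lbrakk>i < n; a \<in> carrier A; q \<in> carrier T\<rbrakk> \<Longrightarrow> f i (ract q a) = f i q \<otimes> a"
      "\<And>i c q. \<lbrakk>i < n; c \<in> carrier R; q \<in> carrier T\<rbrakk> \<Longrightarrow> f i (lact (\<rho> c) q) = \<rho> c \<otimes> f i q"
    and u: "\<And>i. i < n \<Longrightarrow> u i \<in> carrier C2"
    and dual: "\<And>q. q \<in> carrier T \<Longrightarrow> q = finprod T (\<lambda>i. ract (u i) (f i q)) {..<n}"
    by (rule left_depth_two_dual_basis[OF assms]) blast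
  have f_closed: "f i q \<in> carrier A" if "i < n" "q \<in> carrier T" for i q
    using hom_in_carrier[OF f(1)] that by auto
  define \<beta> where "\<beta> i = (\<lambda>x\<in>carrier A. f i (pure x \<one>))" for i
  have "\<beta> i \<in> carrier S" if i: "i < n" for i
  proof (rule bimod_EndI)
    fix a b assume ab: "a \<in> carrier A" "b \<in> carrier A"
    show "\<beta> i a \<in> carrier A"
      using ab i by (simp add: \<beta>_def f_closed)
    show "\<beta> i (a \<oplus> b) = \<beta> i a \<oplus> \<beta> i b"
      using ab hom_mult[OF f(1)[OF i], of "pure a \<one>" "pure b \<one>"] by (simp add: \<beta>_def pure_add_left)
  next
    fix c a assume *: "c \<in> carrier R" "a \<in> carrier A"
    then show "\<beta> i (\<rho> c \<otimes> a) = \<rho> c \<otimes> \<beta> i a"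
      using f(3)[OF i *(1), of "pure a \<one>"] by (simp add: \<beta>_def)
    \<comment> \<open>Balancing turns the factor next to the tensor sign into the outer right
      action, for which f_i is linear.\<close>
    have "pure (a \<otimes> \<rho> c) \<one> = ract (pure a \<one>) (\<rho> c)"
      using * pure_balanced[of a c \<one>] by simp
    then show "\<beta> i (a \<otimes> \<rho> c) = \<beta> i a \<otimes> \<rho> c"
      using * f(2)[OF i, of "\<rho> c" "pure a \<one>"] by (simp add: \<beta>_def)
  qed (simp add: \<beta>_def)
  moreover have "pure x y = finprod T (\<lambda>i. ract (u i) (\<beta> i x \<otimes> y)) {..<n}"
    if xy: "x \<in> carrier A" "y \<in> carrier A" for x y
  proof -
    have eq: "f i (pure x y) = \<beta> i x \<otimes> y" if i: "i < n" for i
      using f(2)[OF i, of y "pure x \<one>"] xy by (simp add: \<beta>_def)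
    have "pure x y = finprod T (\<lambda>i. ract (u i) (f i (pure x y))) {..<n}"
      using dual xy by simp
    also have "\<dots> = finprod T (\<lambda>i. ract (u i) (\<beta> i x \<otimes> y)) {..<n}"
      using u xy f_closed by (intro T.finprod_cong') (auto simp: eq[symmetric] ext_tensor_centralizer_iff)
    finally show ?thesis .
  qed
  ultimately have "left_D2_quasibases A R \<rho> n \<beta> u"
    using u by (simp add: left_D2_quasibases_def)
  then show thesis
    by (rule that)
qed

text \<open>Contracting the quasibase identity with \<delta> proves this on pure tensors. It is used
  with \<delta> = \<beta>_j and q = x \<otimes> 1 to expand right factors of the coproduct, and with
  \<delta> = \<alpha>(x -) and q = t'_k to expand left ones.\<close>

lemma contract_quasibases:
  assumes qb: "left_D2_quasibases A R \<rho> n \<beta> t" and \<delta>: "right_linear \<delta>" and q: "q \<in> carrier T"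
  shows "contract_left \<delta> q = (\<Oplus>j\<in>{..<n}. contract_left \<delta> (t j) \<otimes> contract_left (\<beta> j) q)"
proof -
  have \<beta>: "\<beta> j \<in> carrier S" and t: "t j \<in> carrier T" if "j < n" for j
    using qb that by (auto simp: left_D2_quasibases_def ext_tensor_centralizer_iff)
  note lin = bimod_End_right_linear[OF \<beta>]
  have hom: "(\<lambda>q. \<Oplus>j\<in>{..<n}. contract_left \<delta> (t j) \<otimes> contract_left (\<beta> j) q) \<in> hom T (add_monoid A)"
    unfolding finsum_def using t
    by (intro finprod_hom[OF A.a_comm_group] hom_comp[OF contract_left_hom[OF lin] mult_left_hom])
      (auto intro!: contract_left_closed[OF \<delta>])
  show ?thesis
  proof (rule tensor_hom_eqI[OF A.a_group contract_left_hom[OF \<delta>] hom _ q])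
    fix x y assume xy: "x \<in> carrier A" "y \<in> carrier A"
    have \<beta>x: "\<beta> j x \<in> carrier A" if "j < n" for j
      using bimod_End_closed[OF \<beta>[OF that] xy(1)] .
    have "contract_left \<delta> (pure x y) = contract_left \<delta> (finprod T (\<lambda>j. ract (t j) (\<beta> j x \<otimes> y)) {..<n})"
      using qb xy by (simp add: left_D2_quasibases_def)
    also have "\<dots> = (\<Oplus>j\<in>{..<n}. contract_left \<delta> (ract (t j) (\<beta> j x \<otimes> y)))"
      unfolding finsum_def using xy t \<beta>x
      by (intro hom_finprod[OF tensor_comm_group A.a_comm_group contract_left_hom[OF \<delta>]]) auto
    also have "\<dots> = (\<Oplus>j\<in>{..<n}. contract_left \<delta> (t j) \<otimes> contract_left (\<beta> j) (pure x y))"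
      using xy t \<beta>x contract_left_closed[OF \<delta>]
      by (intro A.add.finprod_cong')
        (auto simp: contract_left_ract[OF \<delta>] contract_left_pure[OF lin])
    finally show "contract_left \<delta> (pure x y)
        = (\<Oplus>j\<in>{..<n}. contract_left \<delta> (t j) \<otimes> contract_left (\<beta> j) (pure x y))" .
  qed
qed

section \<open>Tensor products over the centralizer and the coproduct\<close>

lemma End_tensor:
  assumes "\<psi> \<in> carrier B \<rightarrow> carrier A"
  shows "tensor V (add_monoid (bimod_End A B \<psi> R \<rho>)) (End_right A) (add_monoid S) (End_left A)"
proof -
  have \<rho>: "\<rho> \<in> carrier R \<rightarrow> carrier A"
    by auto
  show ?thesis
    using A.End_right_closed[OF assms \<rho>] A.End_left_closed[OF \<rho> \<rho>]
    by (intro tensor.intro tensor_axioms.intro A.bimod_End_comm_group assms \<rho>) auto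
qed

text \<open>
  Writing \<open>\<beta>\<^sub>j = \<Sum>\<^sub>k v\<^sub>j\<^sub>k \<beta>'\<^sub>k\<close> with \<open>v\<^sub>j\<^sub>k = \<beta>\<^sub>j(t'\<^sub>k\<^sup>1) t'\<^sub>k\<^sup>2 \<in> V\<close> and moving the \<open>v\<^sub>j\<^sub>k\<close> across the tensor
  sign turns the sum for one system of quasibases into the sum for another.
\<close>

lemma D2_coproduct_independent:
  assumes qb: "left_D2_quasibases A R \<rho> n \<beta> t" and qb': "left_D2_quasibases A R \<rho> n' \<beta>' t'"
    and \<alpha>: "\<alpha> \<in> carrier S"
  shows "finprod (D2_tensor A R \<rho>) (\<lambda>j. D2_pure A R \<rho> (D2_contract A \<alpha> (t j)) (\<beta> j)) {..<n}
    = finprod (D2_tensor A R \<rho>) (\<lambda>j. D2_pure A R \<rho> (D2_contract A \<alpha> (t' j)) (\<beta>' j)) {..<n'}"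
proof -
  have \<rho>: "\<rho> \<in> carrier R \<rightarrow> carrier A"
    by auto
  interpret D: tensor V "add_monoid S" "End_right A" "add_monoid S" "End_left A"
    by (rule End_tensor[OF \<rho>])
  have S: "comm_group (add_monoid S)"
    by (rule A.bimod_End_comm_group[OF \<rho> \<rho>])
  let ?D = "D2_tensor A R \<rho>" and ?pure = "D2_pure A R \<rho>"
  have D: "?D = D.T" "?pure = D.pure"
    by (simp_all add: D2_tensor_def D2_pure_def)
  interpret DG: comm_group ?D
    unfolding D by (rule D.T.comm_group_axioms)
  have \<beta>: "\<beta> j \<in> carrier S" and t: "t j \<in> carrier C2" if "j < n" for j
    using qb that by (auto simp: left_D2_quasibases_def)
  have \<beta>': "\<beta>' j \<in> carrier S" and t': "t' j \<in> carrier C2" if "j < n'" for j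
    using qb' that by (auto simp: left_D2_quasibases_def)
  have tT: "t j \<in> carrier T" if "j < n" for j
    using t[OF that] by (simp add: ext_tensor_centralizer_iff)
  have tT': "t' j \<in> carrier T" if "j < n'" for j
    using t'[OF that] by (simp add: ext_tensor_centralizer_iff)
  define v where "v j k = contract_left (\<beta> j) (t' k)" for j k
  have v: "v j k \<in> carrier V" if "j < n" "k < n'" for j k
    unfolding v_def by (rule contract_left_centralizer[OF \<beta>[OF that(1)] t'[OF that(2)]])
  define c where "c q = D2_contract A \<alpha> q" for q
  have c: "c (t j) \<in> carrier S" if "j < n" for j
    unfolding c_def by (rule D2_contract_closed[OF \<rho> \<alpha> t[OF that]])
  have c': "c (t' k) \<in> carrier S" if "k < n'" for k
    unfolding c_def by (rule D2_contract_closed[OF \<rho> \<alpha> t'[OF that]])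
  note lact_S = A.End_left_closed[OF \<rho> \<rho>] and ract_S = A.End_right_closed[OF \<rho> \<rho>]
  have pure_closed': "?pure f g \<in> carrier ?D" if "f \<in> carrier S" "g \<in> carrier S" for f g
    using D.pure_closed that by (simp add: D)
  \<comment> \<open>Evaluation at x is contraction of x \<otimes> 1, to which the primed quasibase
    identity applies.\<close>
  have \<beta>_eq: "\<beta> j = finsum S (\<lambda>k. End_left A (v j k) (\<beta>' k)) {..<n'}" if j: "j < n" for j
  proof (rule bimod_End_eqI[OF \<beta>[OF j]])
    have terms: "(\<lambda>k. End_left A (v j k) (\<beta>' k)) \<in> {..<n'} \<rightarrow> carrier S"
      using lact_S \<beta>' v j by blast
    then show "finsum S (\<lambda>k. End_left A (v j k) (\<beta>' k)) {..<n'} \<in> carrier S"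
      using comm_monoid.finprod_closed[OF comm_group.axioms(1)[OF S]] by (simp add: finsum_def)
    fix x assume x: "x \<in> carrier A"
    note lin = bimod_End_right_linear[OF \<beta>[OF j]]
    have "\<beta> j x = contract_left (\<beta> j) (pure x \<one>)"
      using x bimod_End_closed[OF \<beta>[OF j]] by (simp add: contract_left_pure[OF lin])
    also have "\<dots> = (\<Oplus>k\<in>{..<n'}. contract_left (\<beta> j) (t' k) \<otimes> contract_left (\<beta>' k) (pure x \<one>))"
      using x by (intro contract_quasibases[OF qb' lin]) auto
    also have "\<dots> = (\<Oplus>k\<in>{..<n'}. End_left A (v j k) (\<beta>' k) x)"
    proof (rule A.add.finprod_cong'[OF refl])
      show "(\<lambda>k. End_left A (v j k) (\<beta>' k) x) \<in> {..<n'} \<rightarrow> carrier A"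
        using terms by (intro funcsetI bimod_End_closed[OF _ x]) (rule funcset_mem)
      show "contract_left (\<beta> j) (t' k) \<otimes> contract_left (\<beta>' k) (pure x \<one>) = End_left A (v j k) (\<beta>' k) x"
        if "k \<in> {..<n'}" for k
        using that x bimod_End_closed[OF \<beta>'[of k] x]
        by (simp add: v_def contract_left_pure[OF bimod_End_right_linear[OF \<beta>'[of k]]])
    qed
    also have "\<dots> = finsum S (\<lambda>k. End_left A (v j k) (\<beta>' k)) {..<n'} x"
      using A.finsum_bimod_End[OF \<rho> \<rho> terms x] by simp
    finally show "\<beta> j x = finsum S (\<lambda>k. End_left A (v j k) (\<beta>' k)) {..<n'} x" .
  qed
  \<comment> \<open>The unprimed identity, contracted against t'_k, expresses the primed left
    factors through the unprimed ones. The coefficients are the same v_jk, now on the right and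
    summed over j, so the two expansions match across the tensor sign.\<close>
  have c_eq: "c (t' k) = finsum S (\<lambda>j. End_right A (c (t j)) (v j k)) {..<n}" if k: "k < n'" for k
  proof (rule bimod_End_eqI[OF c'[OF k]])
    have terms: "(\<lambda>j. End_right A (c (t j)) (v j k)) \<in> {..<n} \<rightarrow> carrier S"
      using ract_S c v k by blast
    then show "finsum S (\<lambda>j. End_right A (c (t j)) (v j k)) {..<n} \<in> carrier S"
      using comm_monoid.finprod_closed[OF comm_group.axioms(1)[OF S]] by (simp add: finsum_def)
    fix x assume x: "x \<in> carrier A"
    note lin = right_linear_translate[OF bimod_End_right_linear[OF \<alpha>] x]
    have "c (t' k) x = (\<Oplus>j\<in>{..<n}. contract_left (\<lambda>y. \<alpha> (x \<otimes> y)) (t j) \<otimes> contract_left (\<beta> j) (t' k))"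
      using x contract_quasibases[OF qb lin tT'[OF k]] by (simp add: c_def D2_contract_apply)
    also have "\<dots> = (\<Oplus>j\<in>{..<n}. End_right A (c (t j)) (v j k) x)"
      using x by (simp add: c_def D2_contract_apply v_def)
    also have "\<dots> = finsum S (\<lambda>j. End_right A (c (t j)) (v j k)) {..<n} x"
      using A.finsum_bimod_End[OF \<rho> \<rho> terms x] by simp
    finally show "c (t' k) x = finsum S (\<lambda>j. End_right A (c (t j)) (v j k)) {..<n} x" .
  qed
  have hom_r: "?pure f \<in> hom (add_monoid S) ?D" if "f \<in> carrier S" for f
    using D.balanced_pure that by (simp add: balanced_def D)
  have hom_l: "(\<lambda>f. ?pure f g) \<in> hom (add_monoid S) ?D" if "g \<in> carrier S" for g
    using D.balanced_pure that by (simp add: balanced_def D)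
  have "finprod ?D (\<lambda>j. ?pure (c (t j)) (\<beta> j)) {..<n}
      = finprod ?D (\<lambda>j. finprod ?D (\<lambda>k. ?pure (c (t j)) (End_left A (v j k) (\<beta>' k))) {..<n'}) {..<n}"
  proof (rule DG.finprod_cong'[OF refl])
    fix j assume "j \<in> {..<n}"
    then have j: "j < n"
      by simp
    have terms: "(\<lambda>k. End_left A (v j k) (\<beta>' k)) \<in> {..<n'} \<rightarrow> carrier (add_monoid S)"
      using lact_S \<beta>' v j by (simp add: Pi_iff)
    show "?pure (c (t j)) (\<beta> j) = finprod ?D (\<lambda>k. ?pure (c (t j)) (End_left A (v j k) (\<beta>' k))) {..<n'}"
      using hom_finprod[OF S DG.comm_group_axioms hom_r[OF c[OF j]] terms] \<beta>_eq[OF j]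
      by (simp add: finsum_def)
  qed (auto intro!: DG.finprod_closed pure_closed' lact_S \<beta>' v c)
  also have "\<dots> = finprod ?D (\<lambda>k. finprod ?D (\<lambda>j. ?pure (c (t j)) (End_left A (v j k) (\<beta>' k))) {..<n}) {..<n'}"
    by (rule DG.finprod_swap) (auto intro!: pure_closed' lact_S \<beta>' v c)
  also have "\<dots> = finprod ?D (\<lambda>k. ?pure (c (t' k)) (\<beta>' k)) {..<n'}"
  proof (rule DG.finprod_cong'[OF refl])
    fix k assume "k \<in> {..<n'}"
    then have k: "k < n'"
      by simp
    have terms: "(\<lambda>j. End_right A (c (t j)) (v j k)) \<in> {..<n} \<rightarrow> carrier (add_monoid S)"
      using ract_S c v k by (simp add: Pi_iff)
    have "finprod ?D (\<lambda>j. ?pure (c (t j)) (End_left A (v j k) (\<beta>' k))) {..<n}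
        = finprod ?D (\<lambda>j. ?pure (End_right A (c (t j)) (v j k)) (\<beta>' k)) {..<n}"
    proof (rule DG.finprod_cong'[OF refl])
      show "?pure (c (t j)) (End_left A (v j k) (\<beta>' k)) = ?pure (End_right A (c (t j)) (v j k)) (\<beta>' k)"
        if "j \<in> {..<n}" for j
        using D.pure_balanced[of "c (t j)" "v j k" "\<beta>' k"] that c v \<beta>' k by (simp add: D)
    qed (auto intro!: pure_closed' ract_S \<beta>' v c k)
    also have "\<dots> = ?pure (c (t' k)) (\<beta>' k)"
      using hom_finprod[OF S DG.comm_group_axioms hom_l[OF \<beta>'[OF k]] terms] c_eq[OF k]
      by (simp add: finsum_def)
    finally show "finprod ?D (\<lambda>j. ?pure (c (t j)) (End_left A (v j k) (\<beta>' k))) {..<n}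
        = ?pure (c (t' k)) (\<beta>' k)" .
  qed (auto intro!: pure_closed' \<beta>' c')
  finally show ?thesis
    by (simp add: c_def)
qed

text \<open>Any given system of quasibases witnesses the definite description, and independence
  makes it unique.\<close>

lemma D2_coproduct_eq:
  assumes "left_D2_quasibases A R \<rho> n \<beta> t" "\<alpha> \<in> carrier S"
  shows "D2_coproduct A R \<rho> \<alpha>
    = finprod (D2_tensor A R \<rho>) (\<lambda>j. D2_pure A R \<rho> (D2_contract A \<alpha> (t j)) (\<beta> j)) {..<n}"
  unfolding D2_coproduct_def
proof (rule the_equality)
  fix w assume "\<exists>n \<beta> t. left_D2_quasibases A R \<rho> n \<beta> t
    \<and> w = finprod (D2_tensor A R \<rho>) (\<lambda>j. D2_pure A R \<rho> (D2_contract A \<alpha> (t j)) (\<beta> j)) {..<n}"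
  then show "w = finprod (D2_tensor A R \<rho>) (\<lambda>j. D2_pure A R \<rho> (D2_contract A \<alpha> (t j)) (\<beta> j)) {..<n}"
    using D2_coproduct_independent[OF _ assms] by blast
qed (use assms in blast)

text \<open>The same formula for \<Delta>(\<alpha>) makes sense in E \<otimes>_V S, since its left
  factors stay in E, and the canonical map carries one reading to the other.\<close>

lemma bimod_End_right_coideal_subring:
  assumes \<psi>: "\<psi> \<in> carrier B \<rightarrow> carrier A" and \<phi>: "\<phi> \<in> carrier R \<rightarrow> carrier B"
    and factor: "\<And>r. r \<in> carrier R \<Longrightarrow> \<rho> r = \<psi> (\<phi> r)" and D2: "left_depth_two A R \<rho>"
  shows "right_coideal_subring V S (End_left A) (End_right A) (D2_coproduct A R \<rho>)
    (carrier (bimod_End A B \<psi> R \<rho>))" (is "right_coideal_subring _ _ _ _ _ (carrier ?E)")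
  unfolding right_coideal_subring_def
proof (intro conjI)
  have \<rho>: "\<rho> \<in> carrier R \<rightarrow> carrier A"
    by auto
  \<comment> \<open>C acts on A through B, so left B-linearity implies left C-linearity.\<close>
  have sub: "carrier ?E \<subseteq> carrier S"
    using \<phi> by (auto simp: bimod_End_def factor Pi_iff)
  show "subring (carrier ?E) S"
    using A.bimod_End_ring[OF \<psi> \<rho>] sub
    by (intro ring.ring_incl_imp_subring[OF A.bimod_End_ring[OF \<rho> \<rho>]])
      (simp_all only: bimod_End_carrier_update)
  show "\<forall>e\<in>carrier ?E. \<forall>v\<in>carrier V. End_right A e v \<in> carrier ?E"
    using A.End_right_closed[OF \<psi> \<rho>] by blast
  interpret D: tensor V "add_monoid S" "End_right A" "add_monoid S" "End_left A"
    by (rule End_tensor[OF \<rho>])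
  interpret ES: tensor V "add_monoid ?E" "End_right A" "add_monoid S" "End_left A"
    by (rule End_tensor[OF \<psi>])
  \<comment> \<open>Restricting the first argument from S to E keeps pure tensors of S \<otimes>_V S
    balanced; this is what makes the canonical map a homomorphism.\<close>
  have bal: "balanced V (add_monoid ?E) (End_right A) (add_monoid S) (End_left A) D.T D.pure"
    unfolding balanced_def
  proof (intro conjI ballI)
    fix g assume "g \<in> carrier (add_monoid S)"
    then have hom: "(\<lambda>f. D.pure f g) \<in> hom (add_monoid S) D.T"
      using D.balanced_pure by (simp add: balanced_def)
    show "(\<lambda>f. D.pure f g) \<in> hom (add_monoid ?E) D.T"
    proof (rule homI)
      fix f f' assume "f \<in> carrier (add_monoid ?E)" "f' \<in> carrier (add_monoid ?E)"
      then show "D.pure (f \<otimes>\<^bsub>add_monoid ?E\<^esub> f') g = D.pure f g \<otimes>\<^bsub>D.T\<^esub> D.pure f' g"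
        using hom_mult[OF hom, of f f'] sub by (simp add: subset_iff)
    qed (use hom_in_carrier[OF hom] sub in \<open>simp add: subset_iff\<close>)
  next
    fix f assume "f \<in> carrier (add_monoid ?E)"
    then have f: "f \<in> carrier (add_monoid S)"
      using sub by auto
    then show "D.pure f \<in> hom (add_monoid S) D.T"
      using D.balanced_pure by (simp add: balanced_def)
    fix v g assume "v \<in> carrier V" "g \<in> carrier (add_monoid S)"
    then show "D.pure (End_right A f v) g = D.pure f (End_left A v g)"
      by (rule D.pure_balanced[OF f])
  qed
  obtain n \<beta> t where qb: "left_D2_quasibases A R \<rho> n \<beta> t"
    by (rule quasibases_exist[OF D2])
  have \<beta>: "\<beta> j \<in> carrier S" and t: "t j \<in> carrier C2" if "j < n" for j
    using qb that by (auto simp: left_D2_quasibases_def)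
  have "D2_coproduct A R \<rho> \<alpha> \<in> tensor_lift D.T D.pure ` carrier ES.T" if \<alpha>: "\<alpha> \<in> carrier ?E" for \<alpha>
  proof
    \<comment> \<open>The preimage of \<Delta>(\<alpha>): the defining sum with its pure tensors
      formed over E and S.\<close>
    let ?q = "finprod ES.T (\<lambda>j. ES.pure (D2_contract A \<alpha> (t j)) (\<beta> j)) {..<n}"
    have c: "D2_contract A \<alpha> (t j) \<in> carrier ?E" if "j < n" for j
      by (rule D2_contract_closed[OF \<psi> \<alpha> t[OF that]])
    have terms: "(\<lambda>j. ES.pure (D2_contract A \<alpha> (t j)) (\<beta> j)) \<in> {..<n} \<rightarrow> carrier ES.T"
      by (intro funcsetI ES.pure_closed) (simp_all add: c \<beta>)
    then show "?q \<in> carrier ES.T"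
      by (rule ES.T.finprod_closed)
    have "tensor_lift D.T D.pure ?q
        = finprod D.T (\<lambda>j. tensor_lift D.T D.pure (ES.pure (D2_contract A \<alpha> (t j)) (\<beta> j))) {..<n}"
      by (rule hom_finprod[OF ES.T.comm_group_axioms D.T.comm_group_axioms
            ES.tensor_lift_hom[OF D.T.comm_group_axioms bal] terms])
    also have "\<dots> = finprod D.T (\<lambda>j. D.pure (D2_contract A \<alpha> (t j)) (\<beta> j)) {..<n}"
    proof (rule D.T.finprod_cong'[OF refl])
      show "(\<lambda>j. D.pure (D2_contract A \<alpha> (t j)) (\<beta> j)) \<in> {..<n} \<rightarrow> carrier D.T"
        using c \<beta> sub by (intro funcsetI D.pure_closed) auto
      show "tensor_lift D.T D.pure (ES.pure (D2_contract A \<alpha> (t j)) (\<beta> j))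
          = D.pure (D2_contract A \<alpha> (t j)) (\<beta> j)" if "j \<in> {..<n}" for j
        using c \<beta> that by (intro ES.tensor_lift_pure[OF D.T.comm_group_axioms bal]) simp_all
    qed
    also have "\<dots> = D2_coproduct A R \<rho> \<alpha>"
      using D2_coproduct_eq[OF qb subsetD[OF sub \<alpha>]] by (simp only: D2_tensor_def D2_pure_def)
    finally show "D2_coproduct A R \<rho> \<alpha> = tensor_lift D.T D.pure ?q" ..
  qed
  then show "D2_coproduct A R \<rho> ` carrier ?E \<subseteq> tensor_lift D.T D.pure `
      carrier (tensor_product V (add_monoid (S\<lparr>carrier := carrier ?E\<rparr>)) (End_right A) (add_monoid S) (End_left A))"
    unfolding bimod_End_carrier_update by (rule image_subsetI)
qed

end

theorem lemma4p3:
  fixes A :: "'a ring" and B :: "'b ring" and C :: "'c ring"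
    and \<phi> :: "'c \<Rightarrow> 'b" and \<psi> :: "'b \<Rightarrow> 'a"
  assumes "ring A" and "ring B" and "ring C"
    and "\<phi> \<in> ring_hom C B" and "\<psi> \<in> ring_hom B A"
    and "right_depth_three A B C \<phi> \<psi>"
  shows "let \<gamma> = \<psi> \<circ> \<phi>;
             V = centralizer_ring A C \<gamma>;
             P = ext_tensor_centralizer A B \<psi> C \<gamma>;
             E = bimod_End A B \<psi> C \<gamma>;
             S = bimod_End A C \<gamma> C \<gamma>
         in fgp_left_module V P (ext_tensor_left A B \<psi>) \<and>
            fgp_right_module V (add_monoid E) (End_right A) \<and>
            (left_depth_two A C \<gamma> \<longrightarrow>
              right_coideal_subring V S (End_left A) (End_right A) (D2_coproduct A C \<gamma>) (carrier E))"
proof -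
  interpret AB: ring_ext A B \<psi>
    using assms by (intro ring_ext.intro ring_ext_axioms.intro)
  interpret AC: ring_ext A C "\<psi> \<circ> \<phi>"
    using assms by (intro ring_ext.intro ring_ext_axioms.intro ring_hom_trans)
  have \<phi>: "\<phi> \<in> carrier C \<rightarrow> carrier B" and \<psi>: "\<psi> \<in> carrier B \<rightarrow> carrier A"
    using assms(4,5) by (auto simp: ring_hom_closed)
  show ?thesis
    unfolding Let_def
    using AB.centralizer_fgp[OF \<phi> assms(6)] AB.bimod_End_fgp[OF \<phi> assms(6)]
      AC.bimod_End_right_coideal_subring[OF \<psi> \<phi>] by simp
qed

end
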